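(* Let $G, K \in \mathbb{R}^{n\times n}$ be invertible matrices such that $I + GK$ is invertible, let $\Pi = G$, and put $S = (I + GK)^{-1}$. Let $\Sigma_r, \Sigma_w \in \mathbb{R}^{n \times n}$ be symmetric positive definite and put $\Lambda = \Sigma_r(\Sigma_r + \Sigma_w)^{-1}$. Let $\{(r_t, w_t)\}_{t\ge 1}$ be a jointly stationary and ergodic process with values in $\mathbb{R}^n \times \mathbb{R}^n$ whose stationary distribution is zero-mean and jointly Gaussian, with $r_t \sim \mathcal{N}(0,\Sigma_r)$, $w_t \sim \mathcal{N}(0,\Sigma_w)$ and $r_t$, $w_t$ uncorrelated. Let $(u_t, y_t)$ be the closed-loop steady-state data determined by $$y_t = G u_t + w_t, \qquad u_t = K(r_t - y_t), \qquad t \ge 1,$$ let $\hat\Pi_T$ be a least-squares (equivalently, maximum likelihood) estimate $$\hat\Pi_T \in \operatorname*{argmax}_{P \in \mathbb{R}^{n\times n}} \frac{1}{T}\sum_{t=1}^T \log \mathcal{N}(y_t; P u_t, \sigma^2 I)$$ with $\sigma > 0$ fixed, and let $\hat\Pi = \lim_{T\to\infty}\hat\Pi_T$ be its almost sure limit. Suppose that $$\tfrac12 (I-\Lambda)(KS)^{-1}G^T + \tfrac12 G (KS)^{-T}(I-\Lambda)^T \prec G G^T .$$ Let $\phi : \mathbb{R}^n \to \mathbb{R}$ be differentiable, strictly convex and radially unbounded, let $\varepsilon > 0$, and let $w \in \mathbb{R}^n$ be constant. Then the system $$\dot u = -\varepsilon\, \hat\Pi^T \nabla_y \phi(y), \qquad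 y = \Pi u + w,$$ is globally asymptotically stable, and its equilibrium point $u^\star$ satisfies $\Pi u^\star + w = \operatorname*{argmin}_{y\in\mathbb{R}^n}\phi(y)$.
   Context: For symmetric matrices, $A \prec B$ means that $B - A$ is positive definite. $M^{-T}$ denotes $(M^{-1})^T$. $\mathcal{N}(y; m, \sigma^2 I)$ denotes the density at $y$ of the Gaussian distribution with mean $m$ and covariance $\sigma^2 I$. $\nabla_y\phi(y)$ is the gradient (column vector) of $\phi$ at $y$. Radially unbounded means $\phi(y)\to\infty$ as $\|y\|\to\infty$. Globally asymptotically stable means that the system has a unique equilibrium point, that this point is Lyapunov stable, and that every solution converges to it as time tends to infinity. The constant $w$ in the differential system is a fixed vector, separate from the random sequence $\{w_t\}$ that generated the data. *)

theory Defs
  imports "HOL-Probability.Probability"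
begin

definition positive_definite :: "real^'n^'n \<Rightarrow> bool" where
  "positive_definite A \<longleftrightarrow> transpose A = A \<and> (\<forall>x. x \<noteq> 0 \<longrightarrow> 0 < x \<bullet> (A *v x))"

definition loewner_less :: "real^'n^'n \<Rightarrow> real^'n^'n \<Rightarrow> bool" (infix "\<prec>\<^sub>L" 50) where
  "A \<prec>\<^sub>L B \<longleftrightarrow> positive_definite (B - A)"

definition mvn_density :: "real^'n \<Rightarrow> real^'n^'n \<Rightarrow> real^'n \<Rightarrow> real" where
  "mvn_density m C y =
     exp (- ((y - m) \<bullet> (matrix_inv C *v (y - m))) / 2) / sqrt ((2 * pi) ^ CARD('n) * det C)"

text \<open>A vector is Gaussian if all its scalar projections are univariate normal, where point
  masses count as normal distributions of variance zero.\<close>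

definition normal_variable :: "'w measure \<Rightarrow> ('w \<Rightarrow> real) \<Rightarrow> bool" where
  "normal_variable M X \<longleftrightarrow> X \<in> borel_measurable M \<and>
     (\<exists>\<mu>. (AE \<omega> in M. X \<omega> = \<mu>) \<or> (\<exists>\<sigma>>0. distributed M lborel X (normal_density \<mu> \<sigma>)))"

definition jointly_gaussian ::
  "'w measure \<Rightarrow> ('w \<Rightarrow> real^'m) \<Rightarrow> ('w \<Rightarrow> real^'n) \<Rightarrow> bool" where
  "jointly_gaussian M X Y \<longleftrightarrow>
     X \<in> borel_measurable M \<and> Y \<in> borel_measurable M \<and>
     (\<forall>a b. normal_variable M (\<lambda>\<omega>. a \<bullet> X \<omega> + b \<bullet> Y \<omega>))"

definition uncorrelated ::
  "'w measure \<Rightarrow> ('w \<Rightarrow> real^'m) \<Rightarrow> ('w \<Rightarrow> real^'n) \<Rightarrow> bool" where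
  "uncorrelated M X Y \<longleftrightarrow>
     (\<forall>i j. (LINT \<omega>|M. X \<omega> $ i * Y \<omega> $ j) = (LINT \<omega>|M. X \<omega> $ i) * (LINT \<omega>|M. Y \<omega> $ j))"

text \<open>Processes are indexed by the times from 1 on. Only the space and the measurable sets of
  the path space are used, not its measure.\<close>

definition path_space :: "(nat \<Rightarrow> 'a::topological_space) measure" where
  "path_space = (\<Pi>\<^sub>M t\<in>{1..}. borel)"

definition path_shift :: "(nat \<Rightarrow> 'a) \<Rightarrow> nat \<Rightarrow> 'a" where
  "path_shift x = (\<lambda>t\<in>{1..}. x (Suc t))"

definition path_law :: "'w measure \<Rightarrow> (nat \<Rightarrow> 'w \<Rightarrow> 'a::topological_space) \<Rightarrow> (nat \<Rightarrow> 'a) measure" where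
  "path_law M X = distr M path_space (\<lambda>\<omega>. \<lambda>t\<in>{1..}. X t \<omega>)"

definition stationary_process :: "'w measure \<Rightarrow> (nat \<Rightarrow> 'w \<Rightarrow> 'a::topological_space) \<Rightarrow> bool" where
  "stationary_process M X \<longleftrightarrow>
     (\<forall>t\<ge>1. X t \<in> borel_measurable M) \<and>
     distr (path_law M X) path_space path_shift = path_law M X"

definition ergodic_process :: "'w measure \<Rightarrow> (nat \<Rightarrow> 'w \<Rightarrow> 'a::topological_space) \<Rightarrow> bool" where
  "ergodic_process M X \<longleftrightarrow>
     (\<forall>A\<in>sets path_space.
        path_shift -` A \<inter> space path_space = A \<longrightarrow> measure (path_law M X) A \<in> {0, 1})"

definition gradient :: "('a::euclidean_space \<Rightarrow> real) \<Rightarrow> 'a \<Rightarrow> 'a" where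
  "gradient f y = (THE D. GDERIV f y :> D)"

definition strictly_convex :: "('a::real_vector \<Rightarrow> real) \<Rightarrow> bool" where
  "strictly_convex f \<longleftrightarrow>
     (\<forall>x y t. x \<noteq> y \<and> 0 < t \<and> t < 1 \<longrightarrow>
        f ((1 - t) *\<^sub>R x + t *\<^sub>R y) < (1 - t) * f x + t * f y)"

definition radially_unbounded :: "('a::real_normed_vector \<Rightarrow> real) \<Rightarrow> bool" where
  "radially_unbounded f \<longleftrightarrow> filterlim f at_top at_infinity"

definition ode_solution ::
  "('a::real_normed_vector \<Rightarrow> 'a) \<Rightarrow> (real \<Rightarrow> 'a) \<Rightarrow> real set \<Rightarrow> bool" where
  "ode_solution f x J \<longleftrightarrow>
     is_interval J \<and> 0 \<in> J \<and> J \<subseteq> {0..} \<and>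
     (\<forall>t\<in>J. (x has_vector_derivative f (x t)) (at t within J))"

definition maximal_ode_solution ::
  "('a::real_normed_vector \<Rightarrow> 'a) \<Rightarrow> (real \<Rightarrow> 'a) \<Rightarrow> real set \<Rightarrow> bool" where
  "maximal_ode_solution f x J \<longleftrightarrow>
     ode_solution f x J \<and>
     \<not> (\<exists>z J'. J \<subset> J' \<and> ode_solution f z J' \<and> (\<forall>t\<in>J. z t = x t))"

definition equilibrium :: "('a::real_normed_vector \<Rightarrow> 'a) \<Rightarrow> 'a \<Rightarrow> bool" where
  "equilibrium f p \<longleftrightarrow> f p = 0"

definition lyapunov_stable :: "('a::real_normed_vector \<Rightarrow> 'a) \<Rightarrow> 'a \<Rightarrow> bool" where
  "lyapunov_stable f p \<longleftrightarrow>
     (\<forall>e>0. \<exists>d>0. \<forall>x J. ode_solution f x J \<and> dist (x 0) p < d \<longrightarrow> (\<forall>t\<in>J. dist (x t) p < e))"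

text \<open>Solutions are not unique for a vector field that is merely continuous, so the conditions range
  over all of them. Solutions may a priori be defined for a finite time only; convergence as time
  tends to infinity includes that no maximal solution ends in finite time.\<close>

definition globally_asymptotically_stable ::
  "('a::real_normed_vector \<Rightarrow> 'a) \<Rightarrow> 'a \<Rightarrow> bool" where
  "globally_asymptotically_stable f p \<longleftrightarrow>
     (\<forall>q. equilibrium f q \<longleftrightarrow> q = p) \<and>
     lyapunov_stable f p \<and>
     (\<forall>x J. maximal_ode_solution f x J \<longrightarrow> J = {0..} \<and> (x \<longlongrightarrow> p) at_top)"

end

theory Submission
  imports Defs "HOL-Complex_Analysis.Great_Picard"
begin

text \<open>In closed loop \<open>u\<^sub>t = K S (r\<^sub>t - w\<^sub>t)\<close>. Dividing the normal equations of the least-squares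
  problem by \<open>T\<close>, the ergodic theorem turns them into
  \<open>(\<Pi>hat - G) K S (\<Sigma>r + \<Sigma>w) = - \<Sigma>w\<close>, that is \<open>\<Pi>hat = G - (I - \<Lambda>) (K S)\<^sup>-\<^sup>1\<close>. The matrix inequality
  then says exactly that the symmetric part of \<open>\<Pi>hat G\<^sup>T\<close> is positive definite, so that \<open>\<phi>\<close> strictly
  decreases along every trajectory away from its minimizer: the derivative of \<open>\<phi>(y)\<close> is
  \<open>- \<epsilon> \<nabla>\<phi>(y)\<^sup>T G \<Pi>hat\<^sup>T \<nabla>\<phi>(y)\<close>. Being convex and differentiable, \<open>\<phi>\<close> has a continuous gradient, hence
  Peano's theorem and compactness of the sublevel sets make all maximal solutions global, and
  Lyapunov's direct method applies.\<close>

section \<open>The ergodic theorem\<close>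

text \<open>Feedback correlates \<open>u\<close> with the noise, so least squares is biased; the
  identification half serves to compute this bias exactly. No empirical covariance is ever inverted:
  for each T the normal equations are linear in the estimate, so they pass to the limit entry by
  entry, and only constant matrices need inverses. Since the limit is a constant matrix, an identity
  that holds almost surely simply holds. The dynamical half is shaped by a gradient that is only
  known to be continuous. Solutions may branch, so every estimate is made along an arbitrary
  solution, and existence enters only to prolong a solution that would stop in finite time. The
  Lyapunov function does double duty: its sublevel sets confine a solution and thereby bound its
  speed, which excludes stopping, and its strict decrease forces convergence.\<close>

primrec max_partial_sum :: "('a \<Rightarrow> real) \<Rightarrow> nat \<Rightarrow> (nat \<Rightarrow> 'a) \<Rightarrow> real" where
  "max_partial_sum f 0 x = 0"
| "max_partial_sum f (Suc n) x = max 0 (f (x 1) + max_partial_sum f n (path_shift x))"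

lemma sum_path_shift:
  "(\<Sum>t=1..Suc n. f (x t)) = f (x 1) + (\<Sum>t=1..n. f (path_shift x t))"
proof -
  have "(\<Sum>t=1..Suc n. f (x t)) = f (x 1) + (\<Sum>t=Suc 1..Suc n. f (x t))"
    by (subst sum.atLeast_Suc_atMost) auto
  also have "(\<Sum>t=Suc 1..Suc n. f (x t)) = (\<Sum>t=1..n. f (x (Suc t)))"
    by (rule sum.shift_bounds_cl_Suc_ivl)
  also have "\<dots> = (\<Sum>t=1..n. f (path_shift x t))"
    by (intro sum.cong) (auto simp: path_shift_def)
  finally show ?thesis .
qed

lemma max_partial_sum_nonneg: "0 \<le> max_partial_sum f n x"
  by (cases n) auto

lemma max_partial_sum_mono: "max_partial_sum f n x \<le> max_partial_sum f (Suc n) x"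
proof (induction n arbitrary: x)
  case (Suc n)
  have "max_partial_sum f n (path_shift x) \<le> max_partial_sum f (Suc n) (path_shift x)"
    by (rule Suc)
  then show ?case
    unfolding max_partial_sum.simps(2)[of f n x] max_partial_sum.simps(2)[of f "Suc n" x]
    by (auto simp del: max_partial_sum.simps)
qed auto

text \<open>Of the link to partial sums only this bound is used, never that the maximum is attained.
  The recursion along the shift makes m_(n+1) = max 0 (f + m_n o T) true by definition, and the
  ergodic argument runs on that identity.\<close>

lemma sum_le_max_partial_sum: "(\<Sum>t=1..n. f (x t)) \<le> max_partial_sum f n x"
proof (induction n arbitrary: x)
  case (Suc n)
  show ?case
    unfolding sum_path_shift using Suc[of "path_shift x"] by simp
qed auto

lemma measurable_path_shift [measurable]:
  "path_shift \<in> measurable path_space path_space"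
  unfolding path_shift_def path_space_def by measurable

lemma borel_measurable_max_partial_sum [measurable]:
  assumes [measurable]: "f \<in> borel_measurable borel"
  shows "max_partial_sum f n \<in> borel_measurable path_space"
proof (induction n)
  case (Suc n)
  note [measurable] = Suc
  have [measurable]: "(\<lambda>x. x (Suc 0)) \<in> measurable path_space borel"
    unfolding path_space_def by measurable
  show ?case by simp measurable
qed auto

text \<open>Let \<open>m\<^sub>n\<close> be the maximum of the first \<open>n\<close> partial sums and \<open>T\<close> the shift. Then
  \<open>m\<^sub>n\<^sub>+\<^sub>1 - m\<^sub>n \<circ> T = max (- m\<^sub>n \<circ> T) f\<close> has nonnegative integral by invariance, but if the partial sums were
  unbounded almost surely it would tend to \<open>f\<close>, whose integral is negative.\<close>

lemma (in prob_space) ergodic_partial_sums_bdd: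
  fixes X :: "nat \<Rightarrow> 'a \<Rightarrow> 'b::topological_space" and f :: "'b \<Rightarrow> real"
  assumes stat: "stationary_process M X" and erg: "ergodic_process M X"
    and f [measurable]: "f \<in> borel_measurable borel"
    and int: "integrable M (\<lambda>\<omega>. f (X 1 \<omega>))"
    and neg: "expectation (\<lambda>\<omega>. f (X 1 \<omega>)) < 0"
  shows "AE \<omega> in M. \<exists>b. \<forall>n. (\<Sum>t=1..n. f (X t \<omega>)) \<le> b"
proof -
  define P where "P = path_law M X"
  define S :: "nat \<Rightarrow> (nat \<Rightarrow> 'b) \<Rightarrow> real" where "S n x = (\<Sum>t=1..n. f (x t))" for n x
  \<comment> \<open>Paths whose partial sums are unbounded above. Thresholds are natural numbers to
    keep the event measurable; it is shift invariant because a shift changes the sums by the single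
    term \<open>f (x 1)\<close>.\<close>
  define A where "A = {x \<in> space path_space. \<forall>b::nat. \<exists>n. real b < S n x}"
  have X [measurable]: "X t \<in> borel_measurable M" if "t \<in> {1..}" for t
    using stat that by (auto simp: stationary_process_def)
  have path [measurable]: "(\<lambda>\<omega>. \<lambda>t\<in>{1..}. X t \<omega>) \<in> measurable M path_space"
    unfolding path_space_def by (rule measurable_restrict) (rule X)
  have sets_P [measurable_cong]: "sets P = sets path_space"
    by (simp add: P_def path_law_def)
  have space_P: "space P = space path_space"
    by (simp add: P_def path_law_def)
  interpret P: prob_space P
    unfolding P_def path_law_def by (rule prob_space_distr) (rule path)
  have inv: "distr P path_space path_shift = P"
    using stat by (simp add: stationary_process_def P_def)
  have coord [measurable]: "(\<lambda>x. x t) \<in> measurable path_space borel" if "t \<in> {1..}" for t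
    unfolding path_space_def using that by (rule measurable_component_singleton)
  have S_meas [measurable]: "S n \<in> borel_measurable path_space" for n
    unfolding S_def by (intro borel_measurable_sum measurable_compose[OF coord f]) auto
  have A_sets [measurable]: "A \<in> sets path_space"
    unfolding A_def by measurable
  have S_Suc: "S (Suc n) x = f (x 1) + S n (path_shift x)" for n x
    unfolding S_def by (rule sum_path_shift)
  have A_shift: "x \<in> A \<longleftrightarrow> path_shift x \<in> A" if x: "x \<in> space path_space" for x
  proof -
    have sx: "path_shift x \<in> space path_space"
      using measurable_space[OF measurable_path_shift x] .
    have "(\<forall>b::nat. \<exists>n. real b < S n x) \<longleftrightarrow> (\<forall>b::nat. \<exists>n. real b < S n (path_shift x))"
    proof safe
      fix b :: nat assume *: "\<forall>b::nat. \<exists>n. real b < S n x"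
      obtain c :: nat where c: "real b + \<bar>f (x 1)\<bar> \<le> real c"
        using real_arch_simple by blast
      obtain n where n: "real c < S n x" using * by blast
      \<comment> \<open>The empty sum is 0 and cannot exceed \<open>real c\<close>, so there is a
        first term to drop.\<close>
      then have "n \<noteq> 0" by (cases n) (auto simp: S_def)
      then obtain k where "n = Suc k" by (cases n) auto
      then have "real c < S (Suc k) x" using n by simp
      then show "\<exists>n. real b < S n (path_shift x)"
        using c S_Suc[of k x] by (intro exI[of _ k]) linarith
    next
      fix b :: nat assume *: "\<forall>b::nat. \<exists>n. real b < S n (path_shift x)"
      obtain c :: nat where c: "real b + \<bar>f (x 1)\<bar> \<le> real c"
        using real_arch_simple by blast
      obtain n where n: "real c < S n (path_shift x)" using * by blast
      then show "\<exists>n. real b < S n x"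
        using c S_Suc[of n x] by (intro exI[of _ "Suc n"]) linarith
    qed
    with x sx show ?thesis by (simp add: A_def)
  qed
  have A_inv: "path_shift -` A \<inter> space path_space = A"
  proof (intro set_eqI iffI)
    fix x assume "x \<in> A"
    moreover have "x \<in> space path_space" using \<open>x \<in> A\<close> unfolding A_def by blast
    ultimately show "x \<in> path_shift -` A \<inter> space path_space" using A_shift by blast
  qed (use A_shift in blast)
  have P01: "P.prob A \<in> {0, 1}"
    unfolding P_def by (rule erg[unfolded ergodic_process_def, rule_format, OF A_sets A_inv])
  have f1: "integrable P (\<lambda>x. f (x 1))"
    unfolding P_def path_law_def by (subst integrable_distr_eq[OF path]) (use int in auto)
  have E1: "P.expectation (\<lambda>x. f (x 1)) = expectation (\<lambda>\<omega>. f (X 1 \<omega>))"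
    unfolding P_def path_law_def by (subst integral_distr[OF path]) auto
  have shift_P: "path_shift \<in> measurable P path_space" by measurable
  have int_shift: "integrable P (\<lambda>x. h (path_shift x))"
    if "integrable P h" for h :: "(nat \<Rightarrow> 'b) \<Rightarrow> real"
    by (rule integrable_distr[OF shift_P]) (simp only: inv that)
  have E_shift: "P.expectation (\<lambda>x. h (path_shift x)) = P.expectation h"
    if "h \<in> borel_measurable path_space" for h :: "(nat \<Rightarrow> 'b) \<Rightarrow> real"
  proof -
    have "P.expectation h = integral\<^sup>L (distr P path_space path_shift) h"
      by (simp add: inv)
    also have "\<dots> = P.expectation (\<lambda>x. h (path_shift x))"
      by (rule integral_distr[OF shift_P that])
    finally show ?thesis by (rule sym)
  qed
  have m_int: "integrable P (max_partial_sum f n)" for n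
  proof (induction n)
    case (Suc n)
    have "integrable P (\<lambda>x. max 0 (f (x 1) + max_partial_sum f n (path_shift x)))"
      using int_shift[OF Suc] f1 by auto
    then show ?case by (simp add: max_partial_sum.simps(2)[abs_def])
  qed (simp add: max_partial_sum.simps(1)[abs_def])
  define D where "D n x = max (- max_partial_sum f n (path_shift x)) (f (x 1))" for n x
  have D_nonneg: "0 \<le> P.expectation (D n)" for n
  proof -
    have "P.expectation (max_partial_sum f n) \<le> P.expectation (max_partial_sum f (Suc n))"
      by (intro integral_mono m_int max_partial_sum_mono)
    moreover have "P.expectation (D n) =
        P.expectation (\<lambda>x. max_partial_sum f (Suc n) x - max_partial_sum f n (path_shift x))"
      by (intro Bochner_Integration.integral_cong) (auto simp: D_def max_def)
    moreover have "\<dots> = P.expectation (max_partial_sum f (Suc n)) - P.expectation (max_partial_sum f n)"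
      unfolding E_shift[OF borel_measurable_max_partial_sum[OF f], symmetric, of n]
      by (rule Bochner_Integration.integral_diff[OF m_int int_shift[OF m_int]])
    ultimately show ?thesis by simp
  qed
  have "P.prob A \<noteq> 1"
  proof
    assume "P.prob A = 1"
    then have AE_A: "AE x in P. x \<in> A"
      by (subst (asm) P.prob_eq_1) (auto simp: sets_P)
    have "(\<lambda>n. P.expectation (D n)) \<longlonglongrightarrow> P.expectation (\<lambda>x. f (x 1))"
    \<comment> \<open>As m_n is nonnegative, \<open>D n x\<close> either equals
      \<open>f (x 1)\<close> or lies between \<open>f (x 1)\<close> and 0, hence the dominating
      function.\<close>
    proof (rule integral_dominated_convergence[where w = "\<lambda>x. \<bar>f (x 1)\<bar>"])
      show "AE x in P. (\<lambda>n. D n x) \<longlonglongrightarrow> f (x 1)"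
        using AE_A
      proof eventually_elim
        case (elim x)
        then have "path_shift x \<in> A" using A_shift[of x] unfolding A_def by blast
        then have unbdd: "\<exists>n. real b < S n (path_shift x)" for b :: nat
          unfolding A_def by simp
        obtain b :: nat where b: "\<bar>f (x 1)\<bar> \<le> real b" using real_arch_simple by blast
        obtain n where "real b < S n (path_shift x)" using unbdd by blast
        with b have n: "\<bar>f (x 1)\<bar> < S n (path_shift x)" by (rule le_less_trans)
        \<comment> \<open>Once a partial sum of the shifted path exceeds
          \<open>\<bar>f (x 1)\<bar>\<close>, monotonicity keeps -m_k below \<open>f (x 1)\<close>
          for all later k, so the limit is reached after finitely many steps.\<close>
        have "D k x = f (x 1)" if "n \<le> k" for k
        proof -
          have "S n (path_shift x) \<le> max_partial_sum f n (path_shift x)"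
            unfolding S_def by (rule sum_le_max_partial_sum)
          also have "\<dots> \<le> max_partial_sum f k (path_shift x)"
            by (rule lift_Suc_mono_le[of "\<lambda>k. max_partial_sum f k (path_shift x)", OF _ that])
               (rule max_partial_sum_mono)
          finally show ?thesis using n by (simp add: D_def)
        qed
        then show ?case
          by (intro tendsto_eventually) (auto simp: eventually_sequentially)
      qed
      show "AE x in P. norm (D n x) \<le> \<bar>f (x 1)\<bar>" for n
      proof (rule AE_I2)
        show "norm (D n x) \<le> \<bar>f (x 1)\<bar>" for x
          using max_partial_sum_nonneg[of f n "path_shift x"] by (simp add: D_def max_def)
      qed
      show "D n \<in> borel_measurable P" for n
        unfolding D_def by measurable
    qed (use f1 in auto)
    then have "0 \<le> P.expectation (\<lambda>x. f (x 1))"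
      by (rule LIMSEQ_le_const) (use D_nonneg in auto)
    with neg E1 show False by simp
  qed
  with P01 have "P.prob A = 0" by auto
  then have "AE x in P. x \<notin> A"
    by (subst (asm) P.prob_eq_0) (auto simp: sets_P)
  then have AE_A: "AE \<omega> in M. (\<lambda>t\<in>{1..}. X t \<omega>) \<notin> A"
    unfolding P_def path_law_def by (subst (asm) AE_distr_iff[OF path]) auto
  have bdd: "\<exists>b. \<forall>n. (\<Sum>t=1..n. f (X t \<omega>)) \<le> b"
    if "(\<lambda>t\<in>{1..}. X t \<omega>) \<notin> A" "\<omega> \<in> space M" for \<omega>
  proof -
    have "(\<lambda>t\<in>{1..}. X t \<omega>) \<in> space path_space"
      using measurable_space[OF path that(2)] .
    with that(1) obtain b :: nat where "\<forall>n. S n (\<lambda>t\<in>{1..}. X t \<omega>) \<le> b"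
      by (force simp: A_def not_less)
    moreover have "S n (\<lambda>t\<in>{1..}. X t \<omega>) = (\<Sum>t=1..n. f (X t \<omega>))" for n
      unfolding S_def by (intro sum.cong) auto
    ultimately show ?thesis by auto
  qed
  from AE_A AE_space show ?thesis by eventually_elim (rule bdd)
qed

text \<open>Subtracting slightly more than the mean makes the expectation negative, so the partial
  sums stay below some b. It may depend on the path, but b / n vanishes in the average.\<close>

lemma (in prob_space) ergodic_limsup_average:
  fixes X :: "nat \<Rightarrow> 'a \<Rightarrow> 'b::topological_space" and f :: "'b \<Rightarrow> real"
  assumes stat: "stationary_process M X" and erg: "ergodic_process M X"
    and f [measurable]: "f \<in> borel_measurable borel"
    and int: "integrable M (\<lambda>\<omega>. f (X 1 \<omega>))"
  shows "AE \<omega> in M. \<forall>e>0. \<forall>\<^sub>F n in sequentially.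
           (\<Sum>t=1..n. f (X t \<omega>)) / real n < expectation (\<lambda>\<omega>. f (X 1 \<omega>)) + e"
proof -
  define E where "E = expectation (\<lambda>\<omega>. f (X 1 \<omega>))"
  \<comment> \<open>Slacks 1/(k+1) instead of all e > 0, so that only countably many null sets are
    discarded.\<close>
  have "AE \<omega> in M. \<exists>b. \<forall>n. (\<Sum>t=1..n. f (X t \<omega>) - E - inverse (real (Suc k))) \<le> b" for k
    by (rule ergodic_partial_sums_bdd[OF stat erg, where f = "\<lambda>x. f x - E - inverse (real (Suc k))"])
       (use int in \<open>auto simp: E_def prob_space\<close>)
  then have "AE \<omega> in M. \<forall>k. \<exists>b. \<forall>n. (\<Sum>t=1..n. f (X t \<omega>) - E - inverse (real (Suc k))) \<le> b"
    by (simp add: AE_all_countable)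
  then show ?thesis
  proof eventually_elim
    case (elim \<omega>)
    show ?case
    proof (intro allI impI)
      fix e :: real assume "0 < e"
      then obtain k where k: "inverse (real (Suc k)) < e"
        using reals_Archimedean by blast
      obtain b where b: "(\<Sum>t=1..n. f (X t \<omega>) - E - inverse (real (Suc k))) \<le> b" for n
        using elim by blast
      have "(\<lambda>n. E + inverse (real (Suc k)) + b / real n) \<longlonglongrightarrow> E + inverse (real (Suc k)) + 0"
        by (intro tendsto_intros lim_const_over_n)
      then have "\<forall>\<^sub>F n in sequentially. E + inverse (real (Suc k)) + b / real n < E + e"
        using k by (intro order_tendstoD) auto
      moreover have "\<forall>\<^sub>F n in sequentially. n > (0::nat)" by (rule eventually_gt_at_top)
      ultimately show "\<forall>\<^sub>F n in sequentially.
          (\<Sum>t=1..n. f (X t \<omega>)) / real n < expectation (\<lambda>\<omega>. f (X 1 \<omega>)) + e"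
      proof eventually_elim
        case (elim n)
        have "(\<Sum>t=1..n. f (X t \<omega>)) \<le> real n * (E + inverse (real (Suc k))) + b"
          using b[of n] by (simp add: sum_subtractf algebra_simps)
        then have "(\<Sum>t=1..n. f (X t \<omega>)) / real n \<le> E + inverse (real (Suc k)) + b / real n"
          using elim(2) by (simp add: pos_divide_le_eq distrib_right mult.commute[of "real n"])
        with elim(1) show ?case by (simp add: E_def)
      qed
    qed
  qed
qed

text \<open>The upper estimate, applied to f and to -f, gives both halves of the limit.\<close>

theorem (in prob_space) ergodic_average:
  fixes X :: "nat \<Rightarrow> 'a \<Rightarrow> 'b::topological_space" and f :: "'b \<Rightarrow> real"
  assumes stat: "stationary_process M X" and erg: "ergodic_process M X"
    and f [measurable]: "f \<in> borel_measurable borel"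
    and int: "integrable M (\<lambda>\<omega>. f (X 1 \<omega>))"
  shows "AE \<omega> in M. (\<lambda>n. (\<Sum>t=1..n. f (X t \<omega>)) / real n) \<longlonglongrightarrow> expectation (\<lambda>\<omega>. f (X 1 \<omega>))"
  using ergodic_limsup_average[OF stat erg f int]
    ergodic_limsup_average[OF stat erg, of "\<lambda>x. - f x", OF borel_measurable_uminus[OF f] integrable_minus[OF int]]
proof eventually_elim
  case (elim \<omega>)
  show ?case
  proof (rule order_tendstoI)
    fix a assume "a < expectation (\<lambda>\<omega>. f (X 1 \<omega>))"
    then have "\<forall>\<^sub>F n in sequentially. - (\<Sum>t=1..n. f (X t \<omega>)) / real n < - a"
      using elim(2)[rule_format, of "expectation (\<lambda>\<omega>. f (X 1 \<omega>)) - a"]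
      by (simp add: sum_negf integral_minus)
    then show "\<forall>\<^sub>F n in sequentially. a < (\<Sum>t=1..n. f (X t \<omega>)) / real n"
      by simp
  next
    fix a assume "expectation (\<lambda>\<omega>. f (X 1 \<omega>)) < a"
    then show "\<forall>\<^sub>F n in sequentially. (\<Sum>t=1..n. f (X t \<omega>)) / real n < a"
      using elim(1)[rule_format, of "a - expectation (\<lambda>\<omega>. f (X 1 \<omega>))"] by simp
  qed
qed

section \<open>Moments of Gaussian vectors\<close>

text \<open>Taylor's formula of order two at s and -s: the linear terms cancel and both remainder
  points lie in [-|s|, |s|]. The bounds sandwich the second difference quotients from which the
  variance is read off.\<close>

lemma exp_second_difference_bounds:
  fixes s :: real
  shows "s\<^sup>2 * exp (- \<bar>s\<bar>) \<le> exp s + exp (- s) - 2" and "exp s + exp (- s) - 2 \<le> s\<^sup>2 * exp \<bar>s\<bar>"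
proof -
  obtain a where a: "\<bar>a\<bar> \<le> \<bar>s\<bar>" "exp s = (\<Sum>m<2. s ^ m / fact m) + exp a / fact 2 * s ^ 2"
    using Maclaurin_exp_le[of s 2] by blast
  obtain b where b: "\<bar>b\<bar> \<le> \<bar>- s\<bar>" "exp (- s) = (\<Sum>m<2. (- s) ^ m / fact m) + exp b / fact 2 * (- s) ^ 2"
    using Maclaurin_exp_le[of "- s" 2] by blast
  have eq: "exp s + exp (- s) - 2 = s\<^sup>2 * ((exp a + exp b) / 2)"
    unfolding a(2) b(2) by (simp add: numeral_2_eq_2 field_simps)
  have e: "exp (- \<bar>s\<bar>) \<le> exp a" "exp (- \<bar>s\<bar>) \<le> exp b" "exp a \<le> exp \<bar>s\<bar>" "exp b \<le> exp \<bar>s\<bar>"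
    using a(1) b(1) by auto
  have avg: "l \<le> p \<Longrightarrow> l \<le> q \<Longrightarrow> l \<le> (p + q) / 2" "p \<le> l \<Longrightarrow> q \<le> l \<Longrightarrow> (p + q) / 2 \<le> l"
    for l p q :: real
    by simp_all
  have "exp (- \<bar>s\<bar>) \<le> (exp a + exp b) / 2" by (rule avg(1)[OF e(1,2)])
  then show "s\<^sup>2 * exp (- \<bar>s\<bar>) \<le> exp s + exp (- s) - 2"
    unfolding eq by (rule mult_left_mono) simp
  have "(exp a + exp b) / 2 \<le> exp \<bar>s\<bar>" by (rule avg(2)[OF e(3,4)])
  then show "exp s + exp (- s) - 2 \<le> s\<^sup>2 * exp \<bar>s\<bar>"
    unfolding eq by (rule mult_left_mono) simp
qed

lemma square_le_exp: "(y::real)\<^sup>2 \<le> 2 * (exp y + exp (- y))"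
proof -
  have "1 + \<bar>y\<bar> + \<bar>y\<bar>\<^sup>2 / 2 \<le> exp \<bar>y\<bar>" by (rule exp_lower_Taylor_quadratic) simp
  then have "y\<^sup>2 / 2 \<le> exp \<bar>y\<bar>" by simp
  also have "\<dots> \<le> exp y + exp (- y)" by (cases "0 \<le> y") auto
  finally show ?thesis by simp
qed

context prob_space
begin

text \<open>Nothing is differentiated under the integral: the mean comes from the tangent line of
  exp at 0, the variance from symmetric second differences and dominated convergence.\<close>

lemma centered_normal_mgf_moments:
  fixes Y :: "'a \<Rightarrow> real" and v :: real
  assumes Y [measurable]: "Y \<in> borel_measurable M"
    and mgf: "\<And>t. has_bochner_integral M (\<lambda>\<omega>. exp (t * Y \<omega>)) (exp (t\<^sup>2 * v / 2))"
  shows "integrable M (\<lambda>\<omega>. (Y \<omega>)\<^sup>2)" and "integrable M Y"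
    and "expectation Y = 0" and "expectation (\<lambda>\<omega>. (Y \<omega>)\<^sup>2) = v"
proof -
  have int: "integrable M (\<lambda>\<omega>. exp (t * Y \<omega>))"
    and E: "expectation (\<lambda>\<omega>. exp (t * Y \<omega>)) = exp (t\<^sup>2 * v / 2)" for t
    using mgf[of t] by (auto simp: has_bochner_integral_iff)
  show sq: "integrable M (\<lambda>\<omega>. (Y \<omega>)\<^sup>2)"
  proof (rule Bochner_Integration.integrable_bound)
    show "integrable M (\<lambda>\<omega>. 2 * (exp (1 * Y \<omega>) + exp ((- 1) * Y \<omega>)))"
      by (intro integrable_mult_right Bochner_Integration.integrable_add int)
    show "AE \<omega> in M. norm ((Y \<omega>)\<^sup>2) \<le> norm (2 * (exp (1 * Y \<omega>) + exp ((- 1) * Y \<omega>)))"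
      using square_le_exp by (intro AE_I2) (auto simp: abs_of_pos add_pos_pos)
  qed simp
  show Y_int: "integrable M Y"
    by (rule square_integrable_imp_integrable[OF Y sq])
  \<comment> \<open>From exp z >= 1 + z. Dividing by t > 0 and by t < 0 and letting t tend to 0
    squeezes the mean to 0, because the right-hand side has slope 0 at the origin.\<close>
  have le: "1 + t * expectation Y \<le> exp (t\<^sup>2 * v / 2)" for t
  proof -
    have "1 + t * expectation Y = expectation (\<lambda>\<omega>. 1 + t * Y \<omega>)"
      using Y_int by (simp add: prob_space)
    also have "\<dots> \<le> expectation (\<lambda>\<omega>. exp (t * Y \<omega>))"
      by (intro integral_mono int) (use Y_int exp_ge_add_one_self in auto)
    finally show ?thesis by (simp add: E)
  qed
  have "((\<lambda>t. exp (t\<^sup>2 * v / 2)) has_real_derivative 0) (at 0)"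
    by (auto intro!: derivative_eq_intros)
  then have lim0: "((\<lambda>t. (exp (t\<^sup>2 * v / 2) - 1) / t) \<longlongrightarrow> 0) (at 0)"
    by (simp add: has_field_derivative_iff)
  have "((\<lambda>t. (exp (t\<^sup>2 * v / 2) - 1) / t) \<longlongrightarrow> 0) (at_right 0)"
    by (rule filterlim_mono[OF lim0 order_refl at_le]) simp
  moreover have "\<forall>\<^sub>F t in at_right 0. expectation Y \<le> (exp (t\<^sup>2 * v / 2) - 1) / t"
    unfolding eventually_at_right_field
    by (intro exI[of _ 1]) (use le in \<open>auto simp: pos_le_divide_eq mult.commute add.commute le_diff_eq\<close>)
  ultimately have "expectation Y \<le> 0"
    by (rule tendsto_lowerbound) simp
  moreover have "((\<lambda>t. (exp (t\<^sup>2 * v / 2) - 1) / t) \<longlongrightarrow> 0) (at_left 0)"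
    by (rule filterlim_mono[OF lim0 order_refl at_le]) simp
  then have "0 \<le> expectation Y"
  proof (rule tendsto_upperbound)
    show "\<forall>\<^sub>F t in at_left 0. (exp (t\<^sup>2 * v / 2) - 1) / t \<le> expectation Y"
      unfolding eventually_at_left_field
      by (intro exI[of _ "- 1"]) (use le in \<open>auto simp: neg_divide_le_eq mult.commute add.commute le_diff_eq\<close>)
  qed simp
  ultimately show "expectation Y = 0" by simp
  \<comment> \<open>Any positive null sequence with values at most 1 would do; the bound 1 allows
    one dominating function for all n.\<close>
  define t where "t n = 1 / real (Suc n)" for n
  have t: "0 < t n" "t n \<le> 1" for n by (auto simp: t_def)
  have t0: "t \<longlonglongrightarrow> 0"
    unfolding t_def using LIMSEQ_inverse_real_of_nat by (simp add: inverse_eq_divide)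
  define F where "F n y = (exp (t n * y) + exp (- (t n * y)) - 2) / (t n)\<^sup>2" for n and y :: real
  have F_le: "F n y \<le> y\<^sup>2 * exp (t n * \<bar>y\<bar>)" for n y
    using exp_second_difference_bounds(2)[of "t n * y"] t[of n]
    by (simp add: F_def pos_divide_le_eq abs_mult power_mult_distrib mult_ac)
  have F_ge: "y\<^sup>2 * exp (- (t n * \<bar>y\<bar>)) \<le> F n y" for n y
    using exp_second_difference_bounds(1)[of "t n * y"] t[of n]
    by (simp add: F_def pos_le_divide_eq abs_mult power_mult_distrib mult_ac)
  have lim: "(\<lambda>n. expectation (\<lambda>\<omega>. F n (Y \<omega>))) \<longlonglongrightarrow> expectation (\<lambda>\<omega>. (Y \<omega>)\<^sup>2)"
  \<comment> \<open>Origin of the bound: y^2 <= 2 exp |y| and exp (t n * |y|) <= exp |y| multiply to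
    2 exp (2 |y|), and exp (2 |y|) is at most the sum of the two exponentials.\<close>
  proof (rule integral_dominated_convergence[where w = "\<lambda>\<omega>. 2 * (exp (2 * Y \<omega>) + exp (- 2 * Y \<omega>))"])
    show "integrable M (\<lambda>\<omega>. 2 * (exp (2 * Y \<omega>) + exp (- 2 * Y \<omega>)))"
      by (intro integrable_mult_right Bochner_Integration.integrable_add int)
    show "(\<lambda>\<omega>. F n (Y \<omega>)) \<in> borel_measurable M" for n unfolding F_def by measurable
    show "AE \<omega> in M. (\<lambda>n. F n (Y \<omega>)) \<longlonglongrightarrow> (Y \<omega>)\<^sup>2"
    proof (rule AE_I2)
      fix \<omega>
      have "(\<lambda>n. (Y \<omega>)\<^sup>2 * exp (- (t n * \<bar>Y \<omega>\<bar>))) \<longlonglongrightarrow> (Y \<omega>)\<^sup>2 * exp (- (0 * \<bar>Y \<omega>\<bar>))"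
        by (intro tendsto_intros t0)
      then have l1: "(\<lambda>n. (Y \<omega>)\<^sup>2 * exp (- (t n * \<bar>Y \<omega>\<bar>))) \<longlonglongrightarrow> (Y \<omega>)\<^sup>2" by simp
      have "(\<lambda>n. (Y \<omega>)\<^sup>2 * exp (t n * \<bar>Y \<omega>\<bar>)) \<longlonglongrightarrow> (Y \<omega>)\<^sup>2 * exp (0 * \<bar>Y \<omega>\<bar>)"
        by (intro tendsto_intros t0)
      then have l2: "(\<lambda>n. (Y \<omega>)\<^sup>2 * exp (t n * \<bar>Y \<omega>\<bar>)) \<longlonglongrightarrow> (Y \<omega>)\<^sup>2" by simp
      show "(\<lambda>n. F n (Y \<omega>)) \<longlonglongrightarrow> (Y \<omega>)\<^sup>2"
        by (rule tendsto_sandwich[OF _ _ l1 l2]; rule always_eventually; intro allI F_le F_ge)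
    qed
    show "AE \<omega> in M. norm (F n (Y \<omega>)) \<le> 2 * (exp (2 * Y \<omega>) + exp (- 2 * Y \<omega>))" for n
    proof (rule AE_I2)
      fix \<omega>
      define y where "y = Y \<omega>"
      have "0 \<le> F n y" by (rule order_trans[OF _ F_ge]) simp
      then have "norm (F n y) = F n y" by simp
      also have "\<dots> \<le> y\<^sup>2 * exp (t n * \<bar>y\<bar>)" by (rule F_le)
      also have "\<dots> \<le> (2 * exp \<bar>y\<bar>) * exp \<bar>y\<bar>"
      proof (intro mult_mono)
        have "1 + \<bar>y\<bar> + \<bar>y\<bar>\<^sup>2 / 2 \<le> exp \<bar>y\<bar>" by (rule exp_lower_Taylor_quadratic) simp
        then show "y\<^sup>2 \<le> 2 * exp \<bar>y\<bar>" by simp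
        have "t n * \<bar>y\<bar> \<le> 1 * \<bar>y\<bar>" by (intro mult_right_mono t) simp
        then show "exp (t n * \<bar>y\<bar>) \<le> exp \<bar>y\<bar>" by simp
      qed auto
      also have "\<dots> = 2 * exp (2 * \<bar>y\<bar>)" by (simp add: exp_double power2_eq_square)
      also have "\<dots> \<le> 2 * (exp (2 * y) + exp (- 2 * y))" by (cases "0 \<le> y") auto
      finally show "norm (F n (Y \<omega>)) \<le> 2 * (exp (2 * Y \<omega>) + exp (- 2 * Y \<omega>))"
        by (simp only: y_def)
    qed
  qed simp
  have F_eq: "expectation (\<lambda>\<omega>. F n (Y \<omega>)) = 2 * (exp ((t n)\<^sup>2 * v / 2) - 1) / (t n)\<^sup>2" for n
  proof -
    have "expectation (\<lambda>\<omega>. F n (Y \<omega>)) =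
        (expectation (\<lambda>\<omega>. exp (t n * Y \<omega>)) + expectation (\<lambda>\<omega>. exp ((- t n) * Y \<omega>)) - 2) / (t n)\<^sup>2"
      using int[of "t n"] int[of "- t n"] by (simp add: F_def prob_space)
    then show ?thesis unfolding E by simp
  qed
  have "(\<lambda>n. 2 * (exp ((t n)\<^sup>2 * v / 2) - 1) / (t n)\<^sup>2) \<longlonglongrightarrow> v"
  proof -
    \<comment> \<open>With s = t^2 the second difference quotient has mean 2 (exp (s v / 2) - 1) /
      s, which is a first-order difference quotient in s.\<close>
    have "((\<lambda>s. exp (s * v / 2)) has_real_derivative v / 2) (at 0)"
      by (auto intro!: derivative_eq_intros)
    then have "((\<lambda>s. (exp (s * v / 2) - 1) / s) \<longlongrightarrow> v / 2) (at 0)"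
      by (simp add: has_field_derivative_iff)
    moreover have "filterlim (\<lambda>n. (t n)\<^sup>2) (at 0) sequentially"
      unfolding filterlim_at
    proof
      show "\<forall>\<^sub>F n in sequentially. (t n)\<^sup>2 \<in> UNIV \<and> (t n)\<^sup>2 \<noteq> 0"
        using t(1) by (intro always_eventually) (simp add: less_imp_neq[symmetric])
      show "(\<lambda>n. (t n)\<^sup>2) \<longlonglongrightarrow> 0" using tendsto_power[OF t0, of 2] by simp
    qed
    ultimately have "(\<lambda>n. (exp ((t n)\<^sup>2 * v / 2) - 1) / (t n)\<^sup>2) \<longlonglongrightarrow> v / 2"
      by (rule filterlim_compose)
    from tendsto_mult[OF tendsto_const[of 2] this] show ?thesis by simp
  qed
  with lim[unfolded F_eq] show "expectation (\<lambda>\<omega>. (Y \<omega>)\<^sup>2) = v"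
    by (rule LIMSEQ_unique)
qed

end

section \<open>Positive definite matrices and the moments of a multivariate Gaussian\<close>

lemma positive_definite_invertible:
  assumes "positive_definite C"
  shows "invertible C"
proof -
  have "x = 0" if "C *v x = 0" for x
    using assms that by (force simp: positive_definite_def)
  then have "\<exists>B. B ** C = mat 1" by (simp add: matrix_left_invertible_ker)
  then show ?thesis by (simp add: invertible_left_inverse)
qed

lemma matrix_inv_inverse:
  fixes A :: "'a::semiring_1^'n^'n"
  assumes "invertible A"
  shows "A ** matrix_inv A = mat 1" and "matrix_inv A ** A = mat 1"
  using someI_ex[OF assms[unfolded invertible_def]] by (simp_all add: matrix_inv_def)

lemma matrix_inv_mult_vector:
  fixes A :: "real^'n^'n"
  assumes "invertible A"
  shows "matrix_inv A *v (A *v x) = x" and "A *v (matrix_inv A *v x) = x"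
  using matrix_inv_inverse[OF assms] by (simp_all add: matrix_vector_mul_assoc)

lemma inner_transpose_matrix_vector:
  fixes A :: "real^'n^'m"
  shows "(transpose A *v x) \<bullet> y = x \<bullet> (A *v y)"
  by (simp add: dot_lmul_matrix)

text \<open>Translating a Gaussian density by \<open>C a\<close> tilts it by an exponential factor, so translation
  invariance of the Lebesgue measure yields the moment generating function; the normalising
  constant never has to be computed.\<close>

lemma mvn_density_translate:
  fixes C :: "real^'n^'n"
  assumes C: "positive_definite C"
  shows "mvn_density 0 C (x - C *v a) = mvn_density 0 C x * exp (a \<bullet> x - a \<bullet> (C *v a) / 2)"
proof -
  have inv: "invertible C" by (rule positive_definite_invertible[OF C])
  have sym: "transpose C = C" using C by (simp add: positive_definite_def)
  let ?D = "matrix_inv C"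
  have "(C *v a) \<bullet> (?D *v x) = a \<bullet> (C *v (?D *v x))"
    using inner_transpose_matrix_vector[of C a "?D *v x"] by (simp only: sym)
  then have 1: "(C *v a) \<bullet> (?D *v x) = a \<bullet> x"
    by (simp add: matrix_inv_mult_vector[OF inv])
  have "(x - C *v a) \<bullet> (?D *v (x - C *v a)) =
      x \<bullet> (?D *v x) - x \<bullet> a - (C *v a) \<bullet> (?D *v x) + (C *v a) \<bullet> a"
    by (simp add: matrix_vector_mult_diff_distrib matrix_inv_mult_vector[OF inv] inner_diff_left inner_diff_right)
  also have "\<dots> = x \<bullet> (?D *v x) - 2 * (a \<bullet> x - a \<bullet> (C *v a) / 2)"
    by (simp add: 1 inner_commute)
  finally have "- ((x - C *v a) \<bullet> (?D *v (x - C *v a))) / 2 =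
      - (x \<bullet> (?D *v x)) / 2 + (a \<bullet> x - a \<bullet> (C *v a) / 2)"
    by simp
  then show ?thesis unfolding mvn_density_def diff_zero by (simp only: exp_add) simp
qed

lemma nn_integral_lborel_translate:
  fixes c :: "'a::euclidean_space"
  assumes [measurable]: "f \<in> borel_measurable borel"
  shows "(\<integral>\<^sup>+x. f (x - c) \<partial>lborel) = (\<integral>\<^sup>+x. f x \<partial>lborel)"
proof -
  have "(\<integral>\<^sup>+x. f x \<partial>lborel) = (\<integral>\<^sup>+x. f x \<partial>distr lborel borel ((+) (- c)))"
    by (simp add: lborel_distr_plus)
  also have "\<dots> = (\<integral>\<^sup>+x. f (- c + x) \<partial>lborel)" by (rule nn_integral_distr) auto
  finally show ?thesis by simp
qed

context prob_space
begin

context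
  fixes X :: "'a \<Rightarrow> real^'n" and C :: "real^'n^'n"
  assumes C: "positive_definite C" and X: "distributed M lborel X (mvn_density 0 C)"
begin

lemma mvn_measurable [measurable]: "X \<in> borel_measurable M"
  using X by (simp add: distributed_def)

lemma mvn_mgf: "has_bochner_integral M (\<lambda>\<omega>. exp (a \<bullet> X \<omega>)) (exp (a \<bullet> (C *v a) / 2))"
proof -
  define p where "p x = ennreal (mvn_density 0 C x)" for x :: "real^'n"
  define c where "c = a \<bullet> (C *v a) / 2"
  have dist: "distributed M lborel X p" unfolding p_def by (rule X)
  have p [measurable]: "p \<in> borel_measurable borel"
    using dist by (simp add: distributed_def)
  \<comment> \<open>Nonnegative integrals throughout, so that integrability of the exponential comes
    out together with its mean.\<close>
  have "1 = (\<integral>\<^sup>+\<omega>. 1 \<partial>M)" by (simp add: emeasure_space_1)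
  also have "\<dots> = (\<integral>\<^sup>+x. p x \<partial>lborel)"
    using distributed_nn_integral[OF dist, of "\<lambda>_. 1"] by simp
  also have "\<dots> = (\<integral>\<^sup>+x. p (x - C *v a) \<partial>lborel)"
    by (rule nn_integral_lborel_translate[symmetric]) (rule p)
  also have "\<dots> = (\<integral>\<^sup>+x. p x * ennreal (exp (a \<bullet> x - c)) \<partial>lborel)"
    unfolding p_def mvn_density_translate[OF C] c_def by (simp add: ennreal_mult'')
  also have "\<dots> = (\<integral>\<^sup>+\<omega>. ennreal (exp (a \<bullet> X \<omega> - c)) \<partial>M)"
    by (rule distributed_nn_integral[OF dist]) simp
  finally have "(\<integral>\<^sup>+\<omega>. ennreal (exp (a \<bullet> X \<omega> - c)) \<partial>M) = ennreal 1" by simp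
  then have "has_bochner_integral M (\<lambda>\<omega>. exp (a \<bullet> X \<omega> - c)) 1"
    by (intro has_bochner_integral_nn_integral) auto
  from has_bochner_integral_mult_right[OF this, of "exp c"]
  show ?thesis by (simp add: exp_diff c_def)
qed

lemma mvn_inner_moments:
  "integrable M (\<lambda>\<omega>. (a \<bullet> X \<omega>)\<^sup>2)" "integrable M (\<lambda>\<omega>. a \<bullet> X \<omega>)"
  "expectation (\<lambda>\<omega>. a \<bullet> X \<omega>) = 0" "expectation (\<lambda>\<omega>. (a \<bullet> X \<omega>)\<^sup>2) = a \<bullet> (C *v a)"
proof -
  have mgf: "has_bochner_integral M (\<lambda>\<omega>. exp (t * (a \<bullet> X \<omega>))) (exp (t\<^sup>2 * (a \<bullet> (C *v a)) / 2))" for t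
    using mvn_mgf[of "t *\<^sub>R a"]
    by (simp add: matrix_vector_mult_scaleR power2_eq_square mult.assoc)
  have meas: "(\<lambda>\<omega>. a \<bullet> X \<omega>) \<in> borel_measurable M" by measurable
  note moments = centered_normal_mgf_moments[of "\<lambda>\<omega>. a \<bullet> X \<omega>", OF meas mgf]
  show "integrable M (\<lambda>\<omega>. (a \<bullet> X \<omega>)\<^sup>2)" by (rule moments(1))
  show "integrable M (\<lambda>\<omega>. a \<bullet> X \<omega>)" by (rule moments(2))
  show "expectation (\<lambda>\<omega>. a \<bullet> X \<omega>) = 0" by (rule moments(3))
  show "expectation (\<lambda>\<omega>. (a \<bullet> X \<omega>)\<^sup>2) = a \<bullet> (C *v a)" by (rule moments(4))
qed

lemma mvn_mean: "expectation (\<lambda>\<omega>. X \<omega> $ i) = 0"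
  using mvn_inner_moments(3)[of "axis i 1"] by (simp add: inner_axis')

lemma mvn_square_integrable: "integrable M (\<lambda>\<omega>. (X \<omega> $ i)\<^sup>2)"
  using mvn_inner_moments(1)[of "axis i 1"] by (simp add: inner_axis')

text \<open>Polarisation: for unit vectors a and b the product of two coordinates is a quarter of
  the difference of the squared projections on a + b and a - b, whose means are known.\<close>

lemma mvn_covariance: "expectation (\<lambda>\<omega>. X \<omega> $ i * X \<omega> $ j) = C $ i $ j"
proof -
  define a b where "a = (axis i 1 :: real^'n)" and "b = (axis j 1 :: real^'n)"
  have sym: "transpose C = C" using C by (simp add: positive_definite_def)
  have Cab: "x \<bullet> (C *v y) = y \<bullet> (C *v x)" for x y
    using inner_transpose_matrix_vector[of C x y] by (simp only: sym inner_commute)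
  have "expectation (\<lambda>\<omega>. X \<omega> $ i * X \<omega> $ j) =
      expectation (\<lambda>\<omega>. (((a + b) \<bullet> X \<omega>)\<^sup>2 - ((a - b) \<bullet> X \<omega>)\<^sup>2) / 4)"
    by (intro Bochner_Integration.integral_cong)
       (simp_all add: a_def b_def inner_add_left inner_diff_left inner_axis' power2_eq_square algebra_simps)
  also have "\<dots> = ((a + b) \<bullet> (C *v (a + b)) - (a - b) \<bullet> (C *v (a - b))) / 4"
    using mvn_inner_moments(1)[of "a + b"] mvn_inner_moments(1)[of "a - b"]
    by (simp add: mvn_inner_moments(4))
  also have "\<dots> = a \<bullet> (C *v b)"
    using Cab[of a b]
    by (simp add: matrix_vector_right_distrib matrix_vector_mult_diff_distrib inner_add_left
        inner_add_right inner_diff_left inner_diff_right)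
  also have "\<dots> = C $ i $ j"
    by (simp add: a_def b_def inner_axis' matrix_vector_mul_component inner_axis)
  finally show ?thesis .
qed

end

lemma integrable_product_of_squares:
  fixes Y Z :: "'a \<Rightarrow> real"
  assumes [measurable]: "Y \<in> borel_measurable M" "Z \<in> borel_measurable M"
    and "integrable M (\<lambda>\<omega>. (Y \<omega>)\<^sup>2)" "integrable M (\<lambda>\<omega>. (Z \<omega>)\<^sup>2)"
  shows "integrable M (\<lambda>\<omega>. Y \<omega> * Z \<omega>)"
proof (rule Bochner_Integration.integrable_bound)
  show "integrable M (\<lambda>\<omega>. (Y \<omega>)\<^sup>2 + (Z \<omega>)\<^sup>2)" using assms by simp
  have "\<bar>y * z\<bar> \<le> y\<^sup>2 + z\<^sup>2" for y z :: real
  proof -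
    have "2 * (\<bar>y\<bar> * \<bar>z\<bar>) \<le> y\<^sup>2 + z\<^sup>2"
      using sum_squares_bound[of "\<bar>y\<bar>" "\<bar>z\<bar>"] by (simp only: power2_abs mult.assoc)
    moreover have "0 \<le> \<bar>y\<bar> * \<bar>z\<bar>" by simp
    ultimately show ?thesis unfolding abs_mult by linarith
  qed
  then show "AE \<omega> in M. norm (Y \<omega> * Z \<omega>) \<le> norm ((Y \<omega>)\<^sup>2 + (Z \<omega>)\<^sup>2)"
    by (intro AE_I2) (simp add: abs_of_nonneg)
qed simp

end

section \<open>Identification in closed loop\<close>

text \<open>The constant depends neither on the mean nor on the observation, which turns maximum
  likelihood into least squares; its value can stay hidden.\<close>

lemma ln_mvn_density_isotropic:
  fixes y m :: "real^'n"
  assumes "\<sigma> > 0"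
  obtains c where "\<And>m y :: real^'n. ln (mvn_density m (\<sigma>\<^sup>2 *\<^sub>R mat 1) y) = c - (norm (y - m))\<^sup>2 / (2 * \<sigma>\<^sup>2)"
proof -
  let ?C = "\<sigma>\<^sup>2 *\<^sub>R mat 1 :: real^'n^'n"
  have pos: "\<sigma>\<^sup>2 > 0" using assms by simp
  have inv: "invertible ?C"
    using pos by (intro scalar_invertible) (auto simp: invertible_def intro!: exI[of _ "mat 1"])
  have C: "?C *v x = \<sigma>\<^sup>2 *\<^sub>R x" for x
    by (simp add: scaleR_matrix_vector_assoc[symmetric])
  have D: "matrix_inv ?C *v x = (1 / \<sigma>\<^sup>2) *\<^sub>R x" for x
  proof -
    have "matrix_inv ?C *v (?C *v ((1 / \<sigma>\<^sup>2) *\<^sub>R x)) = (1 / \<sigma>\<^sup>2) *\<^sub>R x"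
      by (rule matrix_inv_mult_vector(1)[OF inv])
    then show ?thesis unfolding C using pos by simp
  qed
  have "det ?C = (\<Prod>i\<in>UNIV. ?C $ i $ i)"
    by (rule det_diagonal) (simp add: mat_def)
  then have "det ?C > 0" using pos by (simp add: mat_def)
  define Z where "Z = sqrt ((2 * pi) ^ CARD('n) * det ?C)"
  have Z: "Z > 0" unfolding Z_def using \<open>det ?C > 0\<close> by simp
  have "ln (mvn_density m ?C y) = - ln Z - (norm (y - m))\<^sup>2 / (2 * \<sigma>\<^sup>2)" for m y
  proof -
    have "mvn_density m ?C y = exp (- (norm (y - m))\<^sup>2 / (2 * \<sigma>\<^sup>2)) / Z"
      unfolding mvn_density_def D Z_def by (simp add: dot_square_norm)
    then show ?thesis using Z by (simp add: ln_div)
  qed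
  then show ?thesis by (rule that)
qed

text \<open>First-order optimality without calculus: the parabola s^2 b - 2 s a never becomes
  negative, so its slope at 0 vanishes.\<close>

lemma quadratic_nonneg_linear_term_zero:
  fixes a b :: real
  assumes "\<And>s. 2 * s * a \<le> s\<^sup>2 * b"
  shows "a = 0"
proof (rule ccontr)
  assume "a \<noteq> 0"
  have b: "0 \<le> b" using assms[of 1] assms[of "- 1"] by simp
  \<comment> \<open>The parabola is lowest at a / b; the added 1 keeps the denominator positive when
    b = 0 and still yields a contradiction.\<close>
  define s where "s = a / (b + 1)"
  have a: "a = s * (b + 1)" using b by (simp add: s_def)
  have "2 * s * a \<le> s\<^sup>2 * b" by (rule assms)
  then have "s\<^sup>2 * (b + 2) \<le> 0" unfolding a by (simp add: power2_eq_square algebra_simps)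
  moreover have "0 < s\<^sup>2 * (b + 2)" using b \<open>a \<noteq> 0\<close> a by (intro mult_pos_pos) auto
  ultimately show False by simp
qed

text \<open>Perturbing the maximiser along an arbitrary direction \<open>H\<close>. This applies to
  any maximiser, also when the inputs do not span the space and it is not unique.\<close>

lemma maximum_likelihood_normal_equations:
  fixes u y :: "nat \<Rightarrow> real^'n" and P H :: "real^'n^'n"
  assumes "\<sigma> > 0" and "T \<ge> 1"
    and max: "is_arg_max (\<lambda>P. 1 / real T * (\<Sum>t=1..T. ln (mvn_density (P *v u t) (\<sigma>\<^sup>2 *\<^sub>R mat 1) (y t))))
                (\<lambda>_. True) P"
  shows "(\<Sum>t=1..T. (y t - P *v u t) \<bullet> (H *v u t)) = 0"
proof -
  obtain c where c: "\<And>m y :: real^'n. ln (mvn_density m (\<sigma>\<^sup>2 *\<^sub>R mat 1) y) = c - (norm (y - m))\<^sup>2 / (2 * \<sigma>\<^sup>2)"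
    using ln_mvn_density_isotropic[OF \<open>\<sigma> > 0\<close>] by blast
  define q where "q P = (\<Sum>t=1..T. (norm (y t - P *v u t))\<^sup>2)" for P :: "real^'n^'n"
  have L: "(\<Sum>t=1..T. ln (mvn_density (P *v u t) (\<sigma>\<^sup>2 *\<^sub>R mat 1) (y t))) = real T * c - q P / (2 * \<sigma>\<^sup>2)"
    for P :: "real^'n^'n"
    unfolding c q_def by (simp add: sum_subtractf sum_divide_distrib)
  have q_min: "q P \<le> q P'" for P'
  proof -
    have "1 / real T * (real T * c - q P' / (2 * \<sigma>\<^sup>2)) \<le> 1 / real T * (real T * c - q P / (2 * \<sigma>\<^sup>2))"
      using max unfolding is_arg_max_def L by (simp add: not_less)
    moreover have "0 < 1 / real T" using \<open>T \<ge> 1\<close> by simp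
    ultimately have "real T * c - q P' / (2 * \<sigma>\<^sup>2) \<le> real T * c - q P / (2 * \<sigma>\<^sup>2)"
      by (simp only: mult_le_cancel_left_pos)
    then have "q P / (2 * \<sigma>\<^sup>2) \<le> q P' / (2 * \<sigma>\<^sup>2)" by simp
    then show ?thesis using \<open>\<sigma> > 0\<close> by (simp add: divide_le_cancel)
  qed
  show ?thesis
  proof (rule quadratic_nonneg_linear_term_zero)
    fix s :: real
    have sq: "(norm (a - s *\<^sub>R b))\<^sup>2 = (norm a)\<^sup>2 - 2 * s * (a \<bullet> b) + s\<^sup>2 * (norm b)\<^sup>2" for a b :: "real^'n"
      unfolding power2_norm_eq_inner
      by (simp add: inner_diff_left inner_diff_right inner_commute power2_eq_square algebra_simps)
    have "y t - (P + s *\<^sub>R H) *v u t = (y t - P *v u t) - s *\<^sub>R (H *v u t)" for t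
      by (simp add: matrix_vector_mult_add_rdistrib scaleR_matrix_vector_assoc[symmetric])
    then have "(norm (y t - (P + s *\<^sub>R H) *v u t))\<^sup>2 =
        (norm (y t - P *v u t))\<^sup>2 - 2 * s * ((y t - P *v u t) \<bullet> (H *v u t)) + s\<^sup>2 * (norm (H *v u t))\<^sup>2" for t
      by (simp only: sq)
    then have "q (P + s *\<^sub>R H) = q P - 2 * s * (\<Sum>t=1..T. (y t - P *v u t) \<bullet> (H *v u t))
        + s\<^sup>2 * (\<Sum>t=1..T. (norm (H *v u t))\<^sup>2)"
      by (simp add: q_def sum.distrib sum_subtractf sum_distrib_left)
    with q_min[of "P + s *\<^sub>R H"]
    show "2 * s * (\<Sum>t=1..T. (y t - P *v u t) \<bullet> (H *v u t)) \<le> s\<^sup>2 * (\<Sum>t=1..T. (norm (H *v u t))\<^sup>2)"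
      by simp
  qed
qed

lemma invertible_matrix_inv:
  fixes A :: "real^'n^'n"
  assumes "invertible A"
  shows "invertible (matrix_inv A)"
  using matrix_inv_inverse[OF assms] by (auto simp: invertible_def)

text \<open>Solving the loop for the tracking error gives (I + GK)(r - y) = r - w.\<close>

lemma closed_loop_input:
  fixes G K :: "real^'n^'n"
  assumes inv: "invertible (mat 1 + G ** K)"
    and y: "y = G *v u + w" and u: "u = K *v (r - y)"
  shows "u = (K ** matrix_inv (mat 1 + G ** K)) *v (r - w)"
proof -
  have "(mat 1 + G ** K) *v (r - y) = (r - y) + G *v (K *v (r - y))"
    by (simp add: matrix_vector_mult_add_rdistrib matrix_vector_mul_assoc)
  also have "\<dots> = (r - y) + G *v u" by (simp only: u[symmetric])
  also have "\<dots> = r - w" using y by simp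
  finally have "r - y = matrix_inv (mat 1 + G ** K) *v (r - w)"
    using matrix_inv_mult_vector(1)[OF inv, of "r - y"] by simp
  with u show ?thesis by (simp add: matrix_vector_mul_assoc)
qed

text \<open>Limits of the averages in the normal equations, with r - w as regressor. Zero means and
  uncorrelatedness remove the cross terms; the noise contained in the regressor leaves
  \<open>- \<Sigma>w\<close>, the source of the bias.\<close>

lemma (in prob_space) uncorrelated_mvn_difference_moments:
  fixes R W :: "'a \<Rightarrow> real^'n" and \<Sigma>r \<Sigma>w :: "real^'n^'n"
  assumes r: "positive_definite \<Sigma>r" and w: "positive_definite \<Sigma>w"
    and R: "distributed M lborel R (mvn_density 0 \<Sigma>r)"
    and W: "distributed M lborel W (mvn_density 0 \<Sigma>w)"
    and unc: "uncorrelated M R W"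
  shows "integrable M (\<lambda>\<omega>. W \<omega> $ i * (R \<omega> - W \<omega>) $ j)"
    and "expectation (\<lambda>\<omega>. W \<omega> $ i * (R \<omega> - W \<omega>) $ j) = - \<Sigma>w $ i $ j"
    and "integrable M (\<lambda>\<omega>. (R \<omega> - W \<omega>) $ i * (R \<omega> - W \<omega>) $ j)"
    and "expectation (\<lambda>\<omega>. (R \<omega> - W \<omega>) $ i * (R \<omega> - W \<omega>) $ j) = (\<Sigma>r + \<Sigma>w) $ i $ j"
proof -
  have [measurable]: "R \<in> borel_measurable M" "W \<in> borel_measurable M"
    by (rule mvn_measurable[OF r R], rule mvn_measurable[OF w W])
  have meas: "(\<lambda>\<omega>. R \<omega> $ i) \<in> borel_measurable M" "(\<lambda>\<omega>. W \<omega> $ i) \<in> borel_measurable M" for i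
    by (rule measurable_compose[OF _ borel_measurable_continuous_onI[OF linear_continuous_on[OF bounded_linear_vec_nth]]],
        measurable)+
  note sq = mvn_square_integrable[OF r R] mvn_square_integrable[OF w W]
  have RR: "integrable M (\<lambda>\<omega>. R \<omega> $ i * R \<omega> $ j)" for i j
    by (rule integrable_product_of_squares[OF meas(1) meas(1) sq(1) sq(1)])
  have RW: "integrable M (\<lambda>\<omega>. R \<omega> $ i * W \<omega> $ j)" for i j
    by (rule integrable_product_of_squares[OF meas(1) meas(2) sq(1) sq(2)])
  have WR: "integrable M (\<lambda>\<omega>. W \<omega> $ i * R \<omega> $ j)" for i j
    by (rule integrable_product_of_squares[OF meas(2) meas(1) sq(2) sq(1)])
  have WW: "integrable M (\<lambda>\<omega>. W \<omega> $ i * W \<omega> $ j)" for i j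
    by (rule integrable_product_of_squares[OF meas(2) meas(2) sq(2) sq(2)])
  have E_RW: "expectation (\<lambda>\<omega>. R \<omega> $ i * W \<omega> $ j) = 0" for i j
    using unc unfolding uncorrelated_def by (simp add: mvn_mean[OF r R])
  have E_WR: "expectation (\<lambda>\<omega>. W \<omega> $ i * R \<omega> $ j) = 0" for i j
    using E_RW[of j i] by (simp only: mult.commute)
  have eq: "W \<omega> $ i * (R \<omega> - W \<omega>) $ j = W \<omega> $ i * R \<omega> $ j - W \<omega> $ i * W \<omega> $ j" for \<omega>
    by (simp add: right_diff_distrib)
  show "integrable M (\<lambda>\<omega>. W \<omega> $ i * (R \<omega> - W \<omega>) $ j)"
    unfolding eq by (intro Bochner_Integration.integrable_diff WR WW)
  show "expectation (\<lambda>\<omega>. W \<omega> $ i * (R \<omega> - W \<omega>) $ j) = - \<Sigma>w $ i $ j"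
    unfolding eq by (simp add: WR WW E_WR mvn_covariance[OF w W])
  have eq: "(R \<omega> - W \<omega>) $ i * (R \<omega> - W \<omega>) $ j =
      R \<omega> $ i * R \<omega> $ j - R \<omega> $ i * W \<omega> $ j - (W \<omega> $ i * R \<omega> $ j - W \<omega> $ i * W \<omega> $ j)" for \<omega>
    by (simp add: algebra_simps)
  show "integrable M (\<lambda>\<omega>. (R \<omega> - W \<omega>) $ i * (R \<omega> - W \<omega>) $ j)"
    unfolding eq by (intro Bochner_Integration.integrable_diff RR RW WR WW)
  show "expectation (\<lambda>\<omega>. (R \<omega> - W \<omega>) $ i * (R \<omega> - W \<omega>) $ j) = (\<Sigma>r + \<Sigma>w) $ i $ j"
    unfolding eq
    by (simp add: RR RW WR WW E_RW E_WR mvn_covariance[OF r R] mvn_covariance[OF w W])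
qed

text \<open>By the loop equations the residual is w - (P - G) L e. Testing along E L^-1 turns the
  input back into e, so only averages of w e^T and e e^T remain, the ones whose limits are
  computable.\<close>

lemma maximum_likelihood_residual:
  fixes u y e w :: "nat \<Rightarrow> real^'n" and P G L :: "real^'n^'n"
  assumes "\<sigma> > 0" and "T \<ge> 1" and L: "invertible L"
    and y: "\<And>t. t \<in> {1..T} \<Longrightarrow> y t = G *v u t + w t"
    and u: "\<And>t. t \<in> {1..T} \<Longrightarrow> u t = L *v e t"
    and max: "is_arg_max (\<lambda>P. 1 / real T * (\<Sum>t=1..T. ln (mvn_density (P *v u t) (\<sigma>\<^sup>2 *\<^sub>R mat 1) (y t))))
                (\<lambda>_. True) P"
  shows "(\<Sum>t=1..T. w t $ i * e t $ j) / T =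
         (\<Sum>k\<in>UNIV. ((P - G) ** L) $ i $ k * ((\<Sum>t=1..T. e t $ k * e t $ j) / T))"
proof -
  \<comment> \<open>The matrix unit at (i, j), which isolates one scalar equation.\<close>
  define E where "E = (\<chi> a b. if a = i \<and> b = j then 1 else 0 :: real^'n^'n)"
  have E: "x \<bullet> (E *v z) = x $ i * z $ j" for x z
  proof -
    have "(E *v z) $ a = (if a = i then z $ j else 0)" for a
      by (simp add: E_def matrix_vector_mult_def if_distrib[of "\<lambda>c. c * _"] cong: if_cong)
    then show ?thesis by (simp add: inner_vec_def if_distrib[of "\<lambda>c. _ * c"] cong: if_cong)
  qed
  let ?Q = "(P - G) ** L"
  have "0 = (\<Sum>t=1..T. (y t - P *v u t) \<bullet> ((E ** matrix_inv L) *v u t))"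
    by (rule maximum_likelihood_normal_equations[OF assms(1,2) max, symmetric])
  also have "\<dots> = (\<Sum>t=1..T. (w t - ?Q *v e t) $ i * e t $ j)"
  proof (rule sum.cong[OF refl])
    fix t assume t: "t \<in> {1..T}"
    have "(E ** matrix_inv L) *v u t = E *v e t"
      using matrix_inv_mult_vector(1)[OF L, of "e t"] by (simp add: u[OF t] matrix_vector_mul_assoc[symmetric])
    moreover have "y t - P *v u t = w t - ?Q *v e t"
      by (simp add: y[OF t] u[OF t] matrix_vector_mul_assoc[symmetric] matrix_vector_mult_diff_rdistrib)
    ultimately show "(y t - P *v u t) \<bullet> ((E ** matrix_inv L) *v u t) = (w t - ?Q *v e t) $ i * e t $ j"
      by (simp only: E)
  qed
  also have "\<dots> = (\<Sum>t=1..T. w t $ i * e t $ j) - (\<Sum>t=1..T. (?Q *v e t) $ i * e t $ j)"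
    by (simp add: left_diff_distrib sum_subtractf)
  also have "(\<Sum>t=1..T. (?Q *v e t) $ i * e t $ j) = (\<Sum>t=1..T. \<Sum>k\<in>UNIV. ?Q $ i $ k * (e t $ k * e t $ j))"
    by (simp add: matrix_vector_mult_def sum_distrib_right mult.assoc)
  also have "\<dots> = (\<Sum>k\<in>UNIV. ?Q $ i $ k * (\<Sum>t=1..T. e t $ k * e t $ j))"
    by (subst sum.swap) (simp add: sum_distrib_left)
  finally have "(\<Sum>t=1..T. w t $ i * e t $ j) = (\<Sum>k\<in>UNIV. ?Q $ i $ k * (\<Sum>t=1..T. e t $ k * e t $ j))"
    by simp
  then show ?thesis
    by (simp only: sum_divide_distrib[of _ "UNIV :: 'n set"] times_divide_eq_right)
qed

lemma tendsto_matrix_mult_component: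
  fixes A :: "'b \<Rightarrow> real^'n^'m" and B :: "real^'p^'n"
  assumes "(A \<longlongrightarrow> A0) F"
  shows "((\<lambda>x. (A x ** B) $ i $ k) \<longlongrightarrow> (A0 ** B) $ i $ k) F"
  unfolding matrix_matrix_mult_def vec_lambda_beta
  by (intro tendsto_sum tendsto_mult_right tendsto_vec_nth assms)

text \<open>Both sides of each scalar normal equation converge, the averages by the ergodic theorem
  and the coefficients by convergence of the estimates; uniqueness of limits equates them.\<close>

lemma (in prob_space) closed_loop_estimate:
  fixes G K \<Sigma>r \<Sigma>w \<Pi>hat :: "real^'n^'n"
    and r w u y :: "nat \<Rightarrow> 'a \<Rightarrow> real^'n"
    and \<Pi>est :: "nat \<Rightarrow> 'a \<Rightarrow> real^'n^'n"
  defines "L \<equiv> K ** matrix_inv (mat 1 + G ** K)"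
  assumes K: "invertible K" and GK: "invertible (mat 1 + G ** K)"
    and \<Sigma>r: "positive_definite \<Sigma>r" and \<Sigma>w: "positive_definite \<Sigma>w"
    and stat: "stationary_process M (\<lambda>t \<omega>. (r t \<omega>, w t \<omega>))"
    and erg: "ergodic_process M (\<lambda>t \<omega>. (r t \<omega>, w t \<omega>))"
    and r: "distributed M lborel (r 1) (mvn_density 0 \<Sigma>r)"
    and w: "distributed M lborel (w 1) (mvn_density 0 \<Sigma>w)"
    and unc: "uncorrelated M (r 1) (w 1)"
    and y: "\<And>t \<omega>. t \<ge> 1 \<Longrightarrow> \<omega> \<in> space M \<Longrightarrow> y t \<omega> = G *v u t \<omega> + w t \<omega>"
    and u: "\<And>t \<omega>. t \<ge> 1 \<Longrightarrow> \<omega> \<in> space M \<Longrightarrow> u t \<omega> = K *v (r t \<omega> - y t \<omega>)"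
    and "\<sigma> > 0"
    and est: "\<And>T \<omega>. T \<ge> 1 \<Longrightarrow> \<omega> \<in> space M \<Longrightarrow>
           is_arg_max
             (\<lambda>P. 1 / real T * (\<Sum>t=1..T. ln (mvn_density (P *v u t \<omega>) (\<sigma>\<^sup>2 *\<^sub>R mat 1) (y t \<omega>))))
             (\<lambda>_. True) (\<Pi>est T \<omega>)"
    and lim: "AE \<omega> in M. (\<lambda>T. \<Pi>est T \<omega>) \<longlonglongrightarrow> \<Pi>hat"
  shows "(\<Pi>hat - G) ** L ** (\<Sigma>r + \<Sigma>w) = - \<Sigma>w"
proof -
  have L: "invertible L"
    unfolding L_def by (rule invertible_mult[OF K invertible_matrix_inv[OF GK]])
  note moments = uncorrelated_mvn_difference_moments[OF \<Sigma>r \<Sigma>w r w unc]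
  have cont: "(\<lambda>x :: (real^'n) \<times> (real^'n). snd x $ i * (fst x - snd x) $ j) \<in> borel_measurable borel"
    "(\<lambda>x :: (real^'n) \<times> (real^'n). (fst x - snd x) $ i * (fst x - snd x) $ j) \<in> borel_measurable borel"
    for i j
    by (rule borel_measurable_continuous_onI,
        intro continuous_on_mult continuous_on_component continuous_on_diff continuous_on_fst continuous_on_snd continuous_on_id)+
  have avg_we: "AE \<omega> in M. (\<lambda>T. (\<Sum>t=1..T. w t \<omega> $ i * (r t \<omega> - w t \<omega>) $ j) / real T)
      \<longlonglongrightarrow> - \<Sigma>w $ i $ j" for i j
  proof -
    have "integrable M (\<lambda>\<omega>. snd (r 1 \<omega>, w 1 \<omega>) $ i * (fst (r 1 \<omega>, w 1 \<omega>) - snd (r 1 \<omega>, w 1 \<omega>)) $ j)"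
      using moments(1)[of i j] by (simp only: fst_conv snd_conv)
    from ergodic_average[OF stat erg cont(1) this] show ?thesis
      by (simp only: fst_conv snd_conv moments(2))
  qed
  have avg_ee: "AE \<omega> in M. (\<lambda>T. (\<Sum>t=1..T. (r t \<omega> - w t \<omega>) $ i * (r t \<omega> - w t \<omega>) $ j) / real T)
      \<longlonglongrightarrow> (\<Sigma>r + \<Sigma>w) $ i $ j" for i j
  proof -
    have "integrable M (\<lambda>\<omega>. (fst (r 1 \<omega>, w 1 \<omega>) - snd (r 1 \<omega>, w 1 \<omega>)) $ i
        * (fst (r 1 \<omega>, w 1 \<omega>) - snd (r 1 \<omega>, w 1 \<omega>)) $ j)"
      using moments(3)[of i j] by (simp only: fst_conv snd_conv)
    from ergodic_average[OF stat erg cont(2) this] show ?thesis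
      by (simp only: fst_conv snd_conv moments(4))
  qed
  \<comment> \<open>There are finitely many index pairs, so one null set serves all entries.\<close>
  have "AE \<omega> in M. \<forall>i j.
      (\<lambda>T. (\<Sum>t=1..T. w t \<omega> $ i * (r t \<omega> - w t \<omega>) $ j) / real T) \<longlonglongrightarrow> - \<Sigma>w $ i $ j"
    by (intro eventually_all_finite avg_we)
  moreover have "AE \<omega> in M. \<forall>i j.
      (\<lambda>T. (\<Sum>t=1..T. (r t \<omega> - w t \<omega>) $ i * (r t \<omega> - w t \<omega>) $ j) / real T) \<longlonglongrightarrow> (\<Sigma>r + \<Sigma>w) $ i $ j"
    by (intro eventually_all_finite avg_ee)
  ultimately have "AE \<omega> in M. (\<Pi>hat - G) ** L ** (\<Sigma>r + \<Sigma>w) = - \<Sigma>w"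
    using lim AE_space
  proof eventually_elim
    case (elim \<omega>)
    let ?e = "\<lambda>t. r t \<omega> - w t \<omega>" and ?Q = "(\<Pi>hat - G) ** L"
    have "(?Q ** (\<Sigma>r + \<Sigma>w)) $ i $ j = - \<Sigma>w $ i $ j" for i j
    proof -
      let ?a = "\<lambda>T. (\<Sum>t=1..T. w t \<omega> $ i * ?e t $ j) / real T"
      let ?b = "\<lambda>T. \<Sum>k\<in>UNIV. ((\<Pi>est T \<omega> - G) ** L) $ i $ k * ((\<Sum>t=1..T. ?e t $ k * ?e t $ j) / real T)"
      have "?a T = ?b T" if T: "T \<ge> 1" for T
      proof (rule maximum_likelihood_residual[OF \<open>\<sigma> > 0\<close> T L _ _ est[OF T elim(4)]])
        fix t assume "t \<in> {1..T}"
        then have t: "1 \<le> t" by simp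
        show "y t \<omega> = G *v u t \<omega> + w t \<omega>" by (rule y[OF t elim(4)])
        show "u t \<omega> = L *v ?e t"
          unfolding L_def by (rule closed_loop_input[OF GK y[OF t elim(4)] u[OF t elim(4)]])
      qed
      then have "\<forall>\<^sub>F T in sequentially. ?a T = ?b T"
        unfolding eventually_sequentially by blast
      moreover have "?a \<longlonglongrightarrow> - \<Sigma>w $ i $ j" by (rule elim(1)[rule_format])
      ultimately have 1: "?b \<longlonglongrightarrow> - \<Sigma>w $ i $ j"
        by (rule Lim_transform_eventually[rotated])
      have 2: "?b \<longlonglongrightarrow> (\<Sum>k\<in>UNIV. ?Q $ i $ k * (\<Sigma>r + \<Sigma>w) $ k $ j)"
      proof (intro tendsto_sum tendsto_mult tendsto_matrix_mult_component tendsto_diff tendsto_const elim(3))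
        show "(\<lambda>T. (\<Sum>t=1..T. ?e t $ k * ?e t $ j) / real T) \<longlonglongrightarrow> (\<Sigma>r + \<Sigma>w) $ k $ j" for k
          by (rule elim(2)[rule_format])
      qed
      have "(?Q ** (\<Sigma>r + \<Sigma>w)) $ i $ j = (\<Sum>k\<in>UNIV. ?Q $ i $ k * (\<Sigma>r + \<Sigma>w) $ k $ j)"
        by (simp add: matrix_matrix_mult_def)
      also have "\<dots> = - \<Sigma>w $ i $ j" by (rule LIMSEQ_unique[OF 2 1])
      finally show ?thesis .
    qed
    then show ?case by (simp add: vec_eq_iff)
  qed
  \<comment> \<open>The identity does not mention \<omega>, and on a probability space a constant
    statement true almost everywhere is true.\<close>
  then show ?thesis by simp
qed

section \<open>Existence of solutions\<close>

lemma integral_Lipschitz: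
  fixes g :: "real \<Rightarrow> 'a::euclidean_space"
  assumes g: "continuous_on {0..} g" and B: "\<And>s. s \<ge> 0 \<Longrightarrow> norm (g s) \<le> B"
    and s: "0 \<le> s" "0 \<le> t"
  shows "norm (integral {0..t} g - integral {0..s} g) \<le> B * \<bar>t - s\<bar>"
proof -
  have *: "norm (integral {0..b} g - integral {0..a} g) \<le> B * (b - a)" if "0 \<le> a" "a \<le> b" for a b
  proof -
    have c: "continuous_on {a'..b} g" if "0 \<le> a'" for a'
      by (rule continuous_on_subset[OF g]) (use that in auto)
    have "integral {0..a} g + integral {a..b} g = integral {0..b} g"
      by (rule Henstock_Kurzweil_Integration.integral_combine)
         (use that c in \<open>auto intro!: integrable_continuous_real\<close>)
    then have "integral {0..b} g - integral {0..a} g = integral {a..b} g"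
      by (simp add: algebra_simps)
    also have "norm \<dots> \<le> B * (b - a)"
      by (rule integral_bound) (use that c B in auto)
    finally show ?thesis .
  qed
  show ?thesis
  proof (cases "s \<le> t")
    case True
    with *[of s t] s show ?thesis by simp
  next
    case False
    with *[of t s] s show ?thesis by (simp add: norm_minus_commute)
  qed
qed

text \<open>Picard iterates of the equation delayed by \<open>h\<close>; the delay makes the iteration stationary
  on \<open>[0, k h]\<close> from step \<open>k\<close> on, so that it solves the delayed equation without any
  Lipschitz condition.\<close>

primrec delayed_iterate :: "('a::euclidean_space \<Rightarrow> 'a) \<Rightarrow> 'a \<Rightarrow> real \<Rightarrow> nat \<Rightarrow> real \<Rightarrow> 'a" where
  "delayed_iterate f x0 h 0 t = x0"
| "delayed_iterate f x0 h (Suc k) t =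
     x0 + integral {0..t} (\<lambda>s. f (delayed_iterate f x0 h k (max 0 (s - h))))"

context
  fixes f :: "'a::euclidean_space \<Rightarrow> 'a" and B :: real
  assumes f: "continuous_on UNIV f" and B: "\<And>z. norm (f z) \<le> B"
begin

lemma norm_bound_nonneg: "0 \<le> B"
  using B[of 0] norm_ge_zero[of "f 0"] by linarith

text \<open>The constant depends neither on the delay nor on the iteration, which is the
  equicontinuity wanted for Arzela-Ascoli. Continuity of the previous iterate, needed to integrate
  it, comes from the induction hypothesis.\<close>

lemma delayed_iterate_Lipschitz:
  "0 \<le> s \<Longrightarrow> 0 \<le> t \<Longrightarrow>
     norm (delayed_iterate f x0 h k t - delayed_iterate f x0 h k s) \<le> B * \<bar>t - s\<bar>"
proof (induction k arbitrary: s t)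
  case 0
  show ?case using norm_bound_nonneg by simp
next
  case (Suc k)
  have "B-lipschitz_on {0..} (delayed_iterate f x0 h k)"
    unfolding lipschitz_on_def using Suc.IH norm_bound_nonneg by (auto simp: dist_norm)
  then have "continuous_on {0..} (delayed_iterate f x0 h k)"
    by (rule lipschitz_on_continuous_on)
  then have "continuous_on {0..} (\<lambda>s. f (delayed_iterate f x0 h k (max 0 (s - h))))"
    by (rule continuous_on_compose2[OF f continuous_on_compose2[where t = "{0..}"]])
       (auto intro!: continuous_on_max continuous_on_diff continuous_on_const continuous_on_id)
  from integral_Lipschitz[OF this B Suc.prems] show ?case by simp
qed

lemma continuous_on_delayed_iterate: "continuous_on {0..} (delayed_iterate f x0 h k)"
proof -
  have "B-lipschitz_on {0..} (delayed_iterate f x0 h k)"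
    unfolding lipschitz_on_def
    using delayed_iterate_Lipschitz[of _ _ x0 h k] norm_bound_nonneg by (auto simp: dist_norm)
  then show ?thesis by (rule lipschitz_on_continuous_on)
qed

lemma continuous_on_delayed_rhs:
  "continuous_on {0..} (\<lambda>s. f (delayed_iterate f x0 h k (max 0 (s - h))))"
  by (rule continuous_on_compose2[OF f continuous_on_compose2[OF continuous_on_delayed_iterate]])
     (auto intro!: continuous_on_max continuous_on_diff continuous_on_const continuous_on_id)

text \<open>Each iteration looks back by \<open>h\<close>, so values up to time (k+1) h depend on
  the previous iterate up to k h only.\<close>

lemma delayed_iterate_stationary:
  "0 \<le> t \<Longrightarrow> t \<le> real k * h \<Longrightarrow> delayed_iterate f x0 h (Suc k) t = delayed_iterate f x0 h k t"
proof (induction k arbitrary: t)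
  case (Suc k)
  have "integral {0..t} (\<lambda>s. f (delayed_iterate f x0 h (Suc k) (max 0 (s - h)))) =
        integral {0..t} (\<lambda>s. f (delayed_iterate f x0 h k (max 0 (s - h))))"
  proof (rule Henstock_Kurzweil_Integration.integral_cong)
    fix s assume s: "s \<in> {0..t}"
    show "f (delayed_iterate f x0 h (Suc k) (max 0 (s - h))) = f (delayed_iterate f x0 h k (max 0 (s - h)))"
    proof (cases "s \<le> h")
      case True
      \<comment> \<open>Up to time \<open>h\<close> the argument is clipped to 0, where every
        iterate equals \<open>x0\<close>.\<close>
      then have "max 0 (s - h) = 0" by simp
      then show ?thesis by (cases k) simp_all
    next
      case False
      with s Suc.prems show ?thesis
        by (subst Suc.IH) (auto simp: algebra_simps)
    qed
  qed
  then show ?case by (simp only: delayed_iterate.simps)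
qed simp

text \<open>A global bound on the field allows the fixed interval [0, 1]. The solutions of the
  delayed equations have a uniformly convergent subsequence, and its limit solves the equation
  without delay.\<close>

lemma peano_bounded:
  obtains x where "\<And>s t. s \<in> {0..1} \<Longrightarrow> t \<in> {0..1} \<Longrightarrow> norm (x t - x s) \<le> B * \<bar>t - s\<bar>"
    "\<And>t. t \<in> {0..1} \<Longrightarrow> (x has_vector_derivative f (x t)) (at t within {0..1})" "x 0 = x0"
proof -
  \<comment> \<open>With delay 1/(n+1), n+1 iterations exactly cover [0, 1], so \<open>X n\<close>
    solves the delayed equation there.\<close>
  define h where "h n = 1 / real (Suc n)" for n
  define X where "X n = delayed_iterate f x0 (h n) (Suc n)" for n
  have h: "0 < h n" "h n \<le> 1" for n by (auto simp: h_def)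
  note B0 = norm_bound_nonneg
  have X_Lip: "norm (X n t - X n s) \<le> B * \<bar>t - s\<bar>" if "0 \<le> s" "0 \<le> t" for n s t
    unfolding X_def by (rule delayed_iterate_Lipschitz[OF that])
  have X0: "X n 0 = x0" for n by (simp add: X_def)
  have X_eq: "X n t = x0 + integral {0..t} (\<lambda>s. f (X n (max 0 (s - h n))))" if "t \<in> {0..1}" for n t
  proof -
    have "delayed_iterate f x0 (h n) (Suc (Suc n)) t = X n t"
      unfolding X_def by (rule delayed_iterate_stationary) (use that in \<open>auto simp: h_def\<close>)
    then show ?thesis unfolding X_def by (simp only: delayed_iterate.simps)
  qed
  obtain x and k :: "nat \<Rightarrow> nat" where x_cont: "continuous_on {0..1} x" and k: "strict_mono k"
    and lim: "\<And>e. 0 < e \<Longrightarrow> \<exists>N. \<forall>n t. n \<ge> N \<and> t \<in> {0..1} \<longrightarrow> norm (X (k n) t - x t) < e"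
  proof (rule Arzela_Ascoli[of "{0..1::real}" X "norm x0 + B"])
    show "norm (X n t) \<le> norm x0 + B" if "t \<in> {0..1}" for n t
    proof -
      have "norm (X n t) \<le> norm x0 + norm (X n t - X n 0)"
        unfolding X0 by (rule norm_triangle_sub)
      also have "norm (X n t - X n 0) \<le> B * \<bar>t - 0\<bar>"
        by (rule X_Lip) (use that in auto)
      also have "\<dots> \<le> B" using that B0 by (simp add: mult_left_le)
      finally show ?thesis by simp
    qed
    show "\<exists>d>0. \<forall>n s. s \<in> {0..1} \<and> norm (t - s) < d \<longrightarrow> norm (X n t - X n s) < e"
      if t: "t \<in> {0..1}" and e: "0 < e" for t e
    proof (intro exI conjI allI impI)
      \<comment> \<open>B + 1 instead of B, since B may be 0.\<close>
      show "0 < e / (B + 1)" using e B0 by simp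
      fix n s assume s: "s \<in> {0..1} \<and> norm (t - s) < e / (B + 1)"
      have "norm (X n t - X n s) \<le> B * \<bar>t - s\<bar>"
        by (rule X_Lip) (use s t in auto)
      also have "\<dots> \<le> (B + 1) * \<bar>t - s\<bar>" by (intro mult_right_mono) auto
      also have "\<dots> < e" using s B0 by (simp add: field_simps)
      finally show "norm (X n t - X n s) < e" .
    qed
    fix g :: "real \<Rightarrow> 'a" and k :: "nat \<Rightarrow> nat"
    assume g: "continuous_on {0..1} g" "strict_mono k"
      "\<And>e. 0 < e \<Longrightarrow> \<exists>N. \<forall>n t. n \<ge> N \<and> t \<in> {0..1} \<longrightarrow> norm (X (k n) t - g t) < e"
    show thesis by (rule that[OF g(1) g(2)]) (rule g(3))
  qed (rule compact_Icc)
  have lim_t: "(\<lambda>n. X (k n) t) \<longlonglongrightarrow> x t" if "t \<in> {0..1}" for t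
    by (rule LIMSEQ_I) (use lim that in blast)
  have h_lim: "(\<lambda>n. h (k n)) \<longlonglongrightarrow> 0"
  proof -
    have "h \<longlonglongrightarrow> 0" unfolding h_def using LIMSEQ_inverse_real_of_nat by (simp add: inverse_eq_divide)
    from LIMSEQ_subseq_LIMSEQ[OF this k] show ?thesis by (simp add: o_def)
  qed
  \<comment> \<open>The delay displaces the argument by at most h and hence the value by at most B
    h, which tends to 0.\<close>
  have lim_delay: "(\<lambda>n. X (k n) (max 0 (t - h (k n)))) \<longlonglongrightarrow> x t" if t: "t \<in> {0..1}" for t
  proof -
    have "(\<lambda>n. X (k n) (max 0 (t - h (k n))) - X (k n) t) \<longlonglongrightarrow> 0"
    proof (rule Lim_null_comparison)
      show "\<forall>\<^sub>F n in sequentially. norm (X (k n) (max 0 (t - h (k n))) - X (k n) t) \<le> B * h (k n)"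
      proof (intro always_eventually allI)
        fix n
        have "norm (X (k n) (max 0 (t - h (k n))) - X (k n) t) \<le> B * \<bar>max 0 (t - h (k n)) - t\<bar>"
          by (rule X_Lip) (use t in auto)
        also have "\<dots> \<le> B * h (k n)"
          using t h[of "k n"] B0 by (intro mult_left_mono) (auto simp: max_def)
        finally show "norm (X (k n) (max 0 (t - h (k n))) - X (k n) t) \<le> B * h (k n)" .
      qed
      show "(\<lambda>n. B * h (k n)) \<longlonglongrightarrow> 0"
        using tendsto_mult_right_zero[OF h_lim] by simp
    qed
    from tendsto_add[OF this lim_t[OF t]] show ?thesis by simp
  qed
  have x_eq: "x t = x0 + integral {0..t} (\<lambda>s. f (x s))" if t: "t \<in> {0..1}" for t
  proof -
    have "(\<lambda>n. integral {0..t} (\<lambda>s. f (X (k n) (max 0 (s - h (k n)))))) \<longlonglongrightarrow> integral {0..t} (\<lambda>s. f (x s))"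
    proof (rule dominated_convergence(2)[where h = "\<lambda>_. B"])
      show "(\<lambda>s. f (X (k n) (max 0 (s - h (k n))))) integrable_on {0..t}" for n
        unfolding X_def
        by (intro integrable_continuous_real continuous_on_subset[OF continuous_on_delayed_rhs]) auto
      show "(\<lambda>n. f (X (k n) (max 0 (s - h (k n))))) \<longlonglongrightarrow> f (x s)" if "s \<in> {0..t}" for s
        by (rule continuous_on_tendsto_compose[OF f lim_delay]) (use that t in auto)
    qed (use B in auto)
    then have "(\<lambda>n. X (k n) t) \<longlonglongrightarrow> x0 + integral {0..t} (\<lambda>s. f (x s))"
      unfolding X_eq[OF t] by (intro tendsto_intros)
    with lim_t[OF t] show ?thesis by (rule LIMSEQ_unique)
  qed
  show ?thesis
  proof
    show "norm (x t - x s) \<le> B * \<bar>t - s\<bar>" if "s \<in> {0..1}" "t \<in> {0..1}" for s t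
    proof (rule LIMSEQ_le_const2)
      show "(\<lambda>n. norm (X (k n) t - X (k n) s)) \<longlonglongrightarrow> norm (x t - x s)"
        by (intro tendsto_intros lim_t that)
    qed (use that X_Lip in auto)
    show "x 0 = x0" using x_eq[of 0] by simp
    show "(x has_vector_derivative f (x t)) (at t within {0..1})" if t: "t \<in> {0..1}" for t
    proof -
      have "continuous_on {0..1} (\<lambda>s. f (x s))"
        by (rule continuous_on_compose2[OF f x_cont]) auto
      from integral_has_vector_derivative[OF this t]
      have "((\<lambda>t. x0 + integral {0..t} (\<lambda>s. f (x s))) has_vector_derivative f (x t)) (at t within {0..1})"
        using has_vector_derivative_add[OF has_vector_derivative_const] by fastforce
      then show ?thesis
        by (rule has_vector_derivative_transform[OF t, rotated]) (rule x_eq)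
    qed
  qed
qed

end

text \<open>Composing with the projection onto the closed unit ball around \<open>x0\<close> makes
  the field bounded and keeps it continuous; the change is invisible while the solution stays in the
  ball.\<close>

theorem peano:
  fixes f :: "'a::euclidean_space \<Rightarrow> 'a"
  assumes f: "continuous_on UNIV f"
  obtains d x where "0 < d" "x 0 = x0"
    "\<And>t. t \<in> {0..d} \<Longrightarrow> (x has_vector_derivative f (x t)) (at t within {0..d})"
proof -
  define C where "C = cball x0 1"
  have C: "closed C" "convex C" "C \<noteq> {}" "compact C" by (auto simp: C_def)
  have "bounded (f ` C)"
    by (intro compact_imp_bounded compact_continuous_image continuous_on_subset[OF f]) (use C in auto)
  then obtain B where B: "0 < B" "\<And>z. z \<in> C \<Longrightarrow> norm (f z) \<le> B"
    unfolding bounded_pos by blast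
  define g where "g z = f (closest_point C z)" for z
  have g: "continuous_on UNIV g"
    unfolding g_def
    by (rule continuous_on_compose2[OF f continuous_on_closest_point]) (use C in auto)
  have gB: "norm (g z) \<le> B" for z
    unfolding g_def by (intro B closest_point_in_set C)
  obtain x where Lip: "\<And>s t. s \<in> {0..1} \<Longrightarrow> t \<in> {0..1} \<Longrightarrow> norm (x t - x s) \<le> B * \<bar>t - s\<bar>"
    and der: "\<And>t. t \<in> {0..1} \<Longrightarrow> (x has_vector_derivative g (x t)) (at t within {0..1})"
    and x0: "x 0 = x0"
    by (rule peano_bounded[OF g gB, where ?x0.0 = x0]) (rule that)
  \<comment> \<open>At speed at most B, distance 1 takes time at least 1 / B; the other bound is the
    lifetime of the bounded problem.\<close>
  define d where "d = min 1 (1 / B)"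
  show ?thesis
  proof
    show "0 < d" using B by (simp add: d_def)
    show "x 0 = x0" by (rule x0)
    fix t assume t: "t \<in> {0..d}"
    then have t1: "t \<in> {0..1}" by (simp add: d_def)
    have "norm (x t - x 0) \<le> B * \<bar>t - 0\<bar>"
      by (rule Lip) (use t1 in auto)
    also have "\<dots> \<le> B * (1 / B)"
      using t B by (intro mult_left_mono) (auto simp: d_def)
    also have "\<dots> = 1" using B(1) by simp
    finally have "x t \<in> C"
      by (simp add: C_def dist_norm norm_minus_commute x0)
    then have "g (x t) = f (x t)" by (simp add: g_def closest_point_self)
    with der[OF t1] have "(x has_vector_derivative f (x t)) (at t within {0..1})" by simp
    then show "(x has_vector_derivative f (x t)) (at t within {0..d})"
      by (rule has_vector_derivative_within_subset) (simp add: d_def)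
  qed
qed

section \<open>Lyapunov functions\<close>

lemma ode_solution_append:
  fixes f :: "'a::real_normed_vector \<Rightarrow> 'a"
  assumes x: "ode_solution f x {0..T}" and "0 \<le> T"
    and z: "ode_solution f z {0..d}" "z 0 = x T" and d: "0 \<le> d"
  shows "ode_solution f (\<lambda>t. if t \<in> {0..T} then x t else z (t - T)) {0..T + d}"
proof -
  define y where "y t = (if t \<in> {0..T} then x t else z (t - T))" for t
  have "(y has_vector_derivative f (y t)) (at t within {0..T + d})" if t: "t \<in> {0..T + d}" for t
  proof -
    have "((\<lambda>t. if t \<in> {0..T} then x t else z (t - T)) has_vector_derivative
            (if t \<in> {0..T} then f (x t) else f (z (t - T)))) (at t within {0..T + d})"
    \<comment> \<open>The closed intervals share the point \<open>T\<close>; the one-sided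
      derivatives agree there because both are values of \<open>f\<close> at
      \<open>x T = z 0\<close>.\<close>
    proof (rule has_vector_derivative_If_within_closures[where T = "{T..T + d}"])
      show "t \<in> {0..T} \<union> {T..T + d}" using t by auto
      show "{0..T + d} = {0..T} \<union> {T..T + d}" using \<open>0 \<le> T\<close> d by auto
      show "(x has_vector_derivative f (x t)) (at t within {0..T} \<union> closure {0..T} \<inter> closure {T..T + d})"
        if "t \<in> {0..T} \<union> closure {0..T} \<inter> closure {T..T + d}"
      proof -
        have eq: "{0..T} \<union> closure {0..T} \<inter> closure {T..T + d} = {0..T}"
          using \<open>0 \<le> T\<close> d by auto
        show ?thesis using x that unfolding eq by (simp add: ode_solution_def)
      qed
      show "((\<lambda>t. z (t - T)) has_vector_derivative f (z (t - T)))
              (at t within {T..T + d} \<union> closure {0..T} \<inter> closure {T..T + d})"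
        if "t \<in> {T..T + d} \<union> closure {0..T} \<inter> closure {T..T + d}"
      proof -
        have eq: "{T..T + d} \<union> closure {0..T} \<inter> closure {T..T + d} = {T..T + d}"
          using \<open>0 \<le> T\<close> d by auto
        have im: "(\<lambda>t. t - T) ` {T..T + d} = {0..d}"
          using image_add_atLeastAtMost[of "- T" T "T + d"] by simp
        have "t - T \<in> {0..d}" using that unfolding eq by auto
        then have "(z has_vector_derivative f (z (t - T))) (at (t - T) within (\<lambda>t. t - T) ` {T..T + d})"
          using z unfolding im by (simp add: ode_solution_def)
        moreover have "((\<lambda>t. t - T) has_vector_derivative 1) (at t within {T..T + d})"
          using has_vector_derivative_diff[OF has_vector_derivative_id has_vector_derivative_const] by simp
        ultimately have "(z \<circ> (\<lambda>t. t - T) has_vector_derivative 1 *\<^sub>R f (z (t - T))) (at t within {T..T + d})"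
          by (intro vector_diff_chain_within)
        then show ?thesis unfolding eq by (simp add: o_def)
      qed
    qed (use \<open>z 0 = x T\<close> \<open>0 \<le> T\<close> d in auto)
    then show ?thesis unfolding y_def by (simp only: if_distrib[of f])
  qed
  then have "ode_solution f y {0..T + d}"
    using \<open>0 \<le> T\<close> d by (simp add: ode_solution_def is_interval_cc)
  then show ?thesis by (simp only: y_def[abs_def])
qed

text \<open>Bounded velocity makes the solution Lipschitz, hence uniformly continuous, so it has a
  limit at the missing endpoint.\<close>

lemma bounded_solution_extends_closed:
  fixes f :: "'a::euclidean_space \<Rightarrow> 'a"
  assumes f: "continuous_on UNIV f" and x: "ode_solution f x {0..<T}" and T: "0 < T"
    and B: "\<And>t. t \<in> {0..<T} \<Longrightarrow> norm (f (x t)) \<le> B"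
  obtains z where "ode_solution f z {0..T}" "\<And>t. t \<in> {0..<T} \<Longrightarrow> z t = x t"
proof -
  have der: "(x has_vector_derivative f (x t)) (at t within {0..<T})" if "t \<in> {0..<T}" for t
    using x that by (simp add: ode_solution_def)
  have "0 \<le> B" by (rule order_trans[OF norm_ge_zero B[of 0]]) (use T in simp)
  have "B-lipschitz_on {0..<T} x"
    unfolding lipschitz_on_def
  proof (intro conjI ballI)
    fix s t assume st: "s \<in> {0..<T}" "t \<in> {0..<T}"
    show "dist (x s) (x t) \<le> B * dist s t"
      unfolding dist_norm
    proof (rule differentiable_bound[where S = "{0..<T}"])
      show "(x has_derivative (\<lambda>h. h *\<^sub>R f (x t))) (at t within {0..<T})" if "t \<in> {0..<T}" for t
        using der[OF that] by (simp add: has_vector_derivative_def)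
      show "onorm (\<lambda>h. h *\<^sub>R f (x t)) \<le> B" if "t \<in> {0..<T}" for t
        by (rule onorm_le) (use mult_right_mono[OF B[OF that] abs_ge_zero] in \<open>simp add: mult.commute\<close>)
    qed (use st in auto)
  qed (rule \<open>0 \<le> B\<close>)
  then have "uniformly_continuous_on {0..<T} x"
    by (rule lipschitz_on_uniformly_continuous)
  then obtain z where z: "uniformly_continuous_on (closure {0..<T}) z"
    and zx: "\<And>t. t \<in> {0..<T} \<Longrightarrow> x t = z t"
    by (rule uniformly_continuous_on_extension_on_closure) (rule that)
  have cl: "closure {0..<T} = {0..T}" using T by simp
  have zc: "continuous_on {0..T} z"
    using uniformly_continuous_imp_continuous[OF z] by (simp only: cl)
  have fz: "continuous_on {0..T} (\<lambda>s. f (z s))"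
    by (rule continuous_on_compose2[OF f zc]) auto
  have eq: "z t - integral {0..t} (\<lambda>s. f (z s)) = z 0" if "t \<in> {0..<T}" for t
  proof -
    have "((\<lambda>s. f (x s)) has_integral x t - x 0) {0..t}"
    proof (rule fundamental_theorem_of_calculus)
      fix s assume "s \<in> {0..t}"
      then have "s \<in> {0..<T}" using that by auto
      from der[OF this] show "(x has_vector_derivative f (x s)) (at s within {0..t})"
        by (rule has_vector_derivative_within_subset) (use that in auto)
    qed (use that in auto)
    then have "integral {0..t} (\<lambda>s. f (x s)) = x t - x 0" by (rule integral_unique)
    moreover have "integral {0..t} (\<lambda>s. f (x s)) = integral {0..t} (\<lambda>s. f (z s))"
      by (rule Henstock_Kurzweil_Integration.integral_cong) (use that zx in auto)
    ultimately show ?thesis using zx[OF that] zx[of 0] T by simp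
  qed
  \<comment> \<open>The integral equation says that this continuous function is constant on [0, T);
    constancy carries over to the closure and yields the one-sided derivative at
    \<open>T\<close>.\<close>
  have c: "continuous_on (closure {0..<T}) (\<lambda>t. z t - integral {0..t} (\<lambda>s. f (z s)))"
    unfolding cl
    by (intro continuous_on_diff zc indefinite_integral_continuous_1 integrable_continuous_real fz)
  have z_eq: "z t = z 0 + integral {0..t} (\<lambda>s. f (z s))" if "t \<in> {0..T}" for t
    using continuous_constant_on_closure[OF c eq, of t] that unfolding cl by (simp add: algebra_simps)
  have "(z has_vector_derivative f (z t)) (at t within {0..T})" if t: "t \<in> {0..T}" for t
  proof -
    from integral_has_vector_derivative[OF fz t]
    have "((\<lambda>t. z 0 + integral {0..t} (\<lambda>s. f (z s))) has_vector_derivative f (z t)) (at t within {0..T})"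
      using has_vector_derivative_add[OF has_vector_derivative_const] by fastforce
    then show ?thesis
      by (rule has_vector_derivative_transform[OF t, rotated]) (rule z_eq)
  qed
  then have "ode_solution f z {0..T}"
    using T by (simp add: ode_solution_def is_interval_cc)
  then show ?thesis by (rule that) (use zx in auto)
qed

text \<open>A bounded J is an interval starting at 0. If it contains its supremum, Peano's theorem
  continues the solution; if not, the endpoint can be added. Either contradicts maximality.\<close>

lemma maximal_solution_global:
  fixes f :: "'a::euclidean_space \<Rightarrow> 'a"
  assumes f: "continuous_on UNIV f" and x: "maximal_ode_solution f x J"
    and B: "\<And>t. t \<in> J \<Longrightarrow> norm (f (x t)) \<le> B"
  shows "J = {0..}"
proof (rule ccontr)
  assume "J \<noteq> {0..}"
  have sol: "ode_solution f x J"
    and max: "\<And>z J'. ode_solution f z J' \<Longrightarrow> J \<subset> J' \<Longrightarrow> (\<And>t. t \<in> J \<Longrightarrow> z t = x t) \<Longrightarrow> False"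
    using x unfolding maximal_ode_solution_def by blast+
  have J: "is_interval J" "0 \<in> J" "J \<subseteq> {0..}"
    using sol by (auto simp: ode_solution_def)
  have mem: "s \<in> J" if "t \<in> J" "0 \<le> s" "s \<le> t" for s t
    using J(1,2) that unfolding is_interval_1 by blast
  obtain b where b: "b \<notin> J" "0 \<le> b" using \<open>J \<noteq> {0..}\<close> J(3) by auto
  have bdd: "bdd_above J"
    by (rule bdd_aboveI[of _ b]) (use mem b in force)
  define T where "T = Sup J"
  have up: "t \<le> T" if "t \<in> J" for t unfolding T_def by (rule cSup_upper[OF that bdd])
  have T0: "0 \<le> T" by (rule up[OF J(2)])
  have below: "t \<in> J" if "0 \<le> t" "t < T" for t
  proof -
    have "J \<noteq> {}" using J(2) by blast
    then have "\<exists>s\<in>J. t < s"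
      using less_cSup_iff[OF _ bdd, of t] \<open>t < T\<close> unfolding T_def by simp
    then obtain s where "s \<in> J" "t < s" by blast
    then show ?thesis using mem[of s t] \<open>0 \<le> t\<close> by simp
  qed
  show False
  proof (cases "T \<in> J")
    case True
    then have JT: "J = {0..T}" using up J(3) mem[OF True] by auto
    obtain d z where d: "0 < d" and z: "z 0 = x T"
      "\<And>t. t \<in> {0..d} \<Longrightarrow> (z has_vector_derivative f (z t)) (at t within {0..d})"
      by (rule peano[OF f, where ?x0.0 = "x T"]) (rule that)
    have "ode_solution f z {0..d}"
      using d z(2) by (simp add: ode_solution_def is_interval_cc)
    then have "ode_solution f (\<lambda>t. if t \<in> {0..T} then x t else z (t - T)) {0..T + d}"
      by (intro ode_solution_append) (use sol JT T0 z d in auto)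
    moreover have "J \<subset> {0..T + d}" unfolding JT using d T0 by (simp add: atLeastatMost_psubset_iff)
    ultimately show False
    proof (rule max)
      show "(if t \<in> {0..T} then x t else z (t - T)) = x t" if "t \<in> J" for t
        using that unfolding JT by (simp only: if_True)
    qed
  next
    case False
    have JT: "J = {0..<T}"
    proof
      show "J \<subseteq> {0..<T}"
      proof
        fix t assume "t \<in> J"
        moreover from this False have "t \<noteq> T" by blast
        ultimately show "t \<in> {0..<T}" using up[of t] J(3) by (simp add: order_less_le subset_iff)
      qed
      show "{0..<T} \<subseteq> J" using below by (simp add: subset_iff)
    qed
    have "0 < T" using J(2) unfolding JT by simp
    have B': "norm (f (x t)) \<le> B" if "t \<in> {0..<T}" for t
      by (rule B) (use that JT in simp)
    obtain z where z: "ode_solution f z {0..T}" "\<And>t. t \<in> {0..<T} \<Longrightarrow> z t = x t"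
      by (rule bounded_solution_extends_closed[OF f sol[unfolded JT] \<open>0 < T\<close> B']) (assumption, rule that)
    have "T \<in> {0..T}" using T0 by simp
    then have "J \<subset> {0..T}" unfolding JT by (intro psubsetI) auto
    from z(1) this show False
      by (rule max) (rule z(2), simp only: JT)
  qed
qed

section \<open>Lyapunov's direct method along possibly non-unique solutions\<close>

context
  fixes f :: "'a::euclidean_space \<Rightarrow> 'a" and V :: "'a \<Rightarrow> real" and g :: "'a \<Rightarrow> 'a" and p :: 'a
  assumes f: "continuous_on UNIV f"
    and V: "\<And>u. GDERIV V u :> g u"
    and V_unbdd: "radially_unbounded V"
    and dV: "continuous_on UNIV (\<lambda>u. f u \<bullet> g u)"
    and fp: "f p = 0"
    and decr: "\<And>u. u \<noteq> p \<Longrightarrow> f u \<bullet> g u < 0"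
    and V_min: "\<And>u. u \<noteq> p \<Longrightarrow> V p < V u"
begin

lemma continuous_on_lyapunov: "continuous_on S V"
  using V has_derivative_continuous_on[of S V "\<lambda>u h. h \<bullet> g u"]
  unfolding gderiv_def by (blast intro: has_derivative_at_withinI)

lemma lyapunov_nonpos: "f u \<bullet> g u \<le> 0"
  using decr[of u] fp by (cases "u = p") auto

lemma compact_sublevel: "compact {u. V u \<le> c}"
proof -
  have "\<forall>\<^sub>F u in at_infinity. c < V u"
    using V_unbdd unfolding radially_unbounded_def filterlim_at_top_dense by blast
  then obtain b where b: "\<And>u. b \<le> norm u \<Longrightarrow> c < V u"
    unfolding eventually_at_infinity by blast
  have "bounded {u. V u \<le> c}"
    by (rule boundedI[of _ b]) (use b in \<open>force simp: not_less[symmetric]\<close>)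
  moreover have "closed {u. V u \<le> c}"
    by (intro closed_Collect_le continuous_on_lyapunov continuous_on_const)
  ultimately show ?thesis by (simp add: compact_eq_bounded_closed)
qed

text \<open>The mean value theorem replaces integrating the decay rate; derivatives within J
  suffice, so the endpoints of J are covered.\<close>

lemma lyapunov_mvt:
  assumes x: "ode_solution f x J" and st: "s \<in> J" "t \<in> J" "s \<le> t"
  obtains \<tau> where "\<tau> \<in> J" "s \<le> \<tau>" "\<tau> \<le> t" "V (x t) - V (x s) = (f (x \<tau>) \<bullet> g (x \<tau>)) * (t - s)"
proof -
  have sub: "{s..t} \<subseteq> J"
    using x st unfolding ode_solution_def is_interval_1 by (meson atLeastAtMost_iff subsetI)
  have "\<exists>\<tau>\<in>{s..t}. V (x t) - V (x s) = (t - s) *\<^sub>R f (x \<tau>) \<bullet> g (x \<tau>)"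
  proof (rule mvt_very_simple[OF \<open>s \<le> t\<close>, where f = "\<lambda>t. V (x t)"])
    fix \<tau> assume \<tau>: "s \<le> \<tau>" "\<tau> \<le> t"
    then have "(x has_vector_derivative f (x \<tau>)) (at \<tau> within J)"
      using x sub by (auto simp: ode_solution_def)
    then have "(x has_derivative (\<lambda>h. h *\<^sub>R f (x \<tau>))) (at \<tau> within {s..t})"
      unfolding has_vector_derivative_def by (rule has_derivative_subset[OF _ sub])
    moreover have "(V has_derivative (\<lambda>h. h \<bullet> g (x \<tau>))) (at (x \<tau>))"
      using V unfolding gderiv_def .
    ultimately show "((\<lambda>t. V (x t)) has_derivative (\<lambda>h. h *\<^sub>R f (x \<tau>) \<bullet> g (x \<tau>))) (at \<tau> within {s..t})"
      by (rule has_derivative_compose)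
  qed
  then show ?thesis using that sub by (auto simp: mult.commute)
qed

lemma lyapunov_antimono:
  assumes x: "ode_solution f x J" and st: "s \<in> J" "t \<in> J" "s \<le> t"
  shows "V (x t) \<le> V (x s)"
proof -
  obtain \<tau> where "V (x t) - V (x s) = (f (x \<tau>) \<bullet> g (x \<tau>)) * (t - s)"
    using lyapunov_mvt[OF assms] by blast
  moreover have "\<dots> \<le> 0" using lyapunov_nonpos st by (intro mult_nonpos_nonneg) auto
  ultimately show ?thesis by simp
qed

text \<open>Turns smallness of V into closeness to \<open>p\<close>: outside the ball, but within a
  compact sublevel set, V attains a minimum, and this exceeds \<open>V p\<close>.\<close>

lemma sublevel_subset_ball:
  assumes "0 < e"
  obtains \<eta> where "0 < \<eta>" "\<And>u. V u < V p + \<eta> \<Longrightarrow> dist u p < e"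
proof -
  define K where "K = {u. V u \<le> V p + 1} - ball p e"
  have K: "compact K" unfolding K_def by (intro compact_diff compact_sublevel) auto
  show ?thesis
  proof (cases "K = {}")
    case True
    show ?thesis
    proof (rule that[of 1])
      show "dist u p < e" if "V u < V p + 1" for u
      proof -
        have "u \<notin> K" using True by simp
        then show ?thesis using that by (simp add: K_def dist_commute)
      qed
    qed simp
  next
    case False
    obtain k where k: "k \<in> K" "\<And>u. u \<in> K \<Longrightarrow> V k \<le> V u"
      using continuous_attains_inf[OF K False continuous_on_lyapunov] by blast
    have "k \<noteq> p" using k(1) \<open>0 < e\<close> by (auto simp: K_def)
    from V_min[OF this] have kp: "V p < V k" .
    show ?thesis
    \<comment> \<open>The 1 keeps u in the sublevel set from which \<open>K\<close> is cut; the
      other bound puts \<open>V u\<close> below the minimum over \<open>K\<close>.\<close>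
    proof (rule that[of "min 1 (V k - V p)"])
      show "dist u p < e" if "V u < V p + min 1 (V k - V p)" for u
      proof -
        have "u \<notin> K" using k(2)[of u] that by auto
        then show ?thesis using that by (simp add: K_def dist_commute)
      qed
    qed (use kp in simp)
  qed
qed

lemma lyapunov_function_stable: "lyapunov_stable f p"
  unfolding lyapunov_stable_def
proof (intro allI impI)
  fix e :: real assume "0 < e"
  obtain \<eta> where \<eta>: "0 < \<eta>" "\<And>u. V u < V p + \<eta> \<Longrightarrow> dist u p < e"
    using sublevel_subset_ball[OF \<open>0 < e\<close>] by blast
  have "isCont V p"
    using continuous_on_lyapunov[of UNIV] by (simp add: continuous_on_eq_continuous_at)
  then obtain d where d: "0 < d" "\<And>u. dist u p < d \<Longrightarrow> dist (V u) (V p) < \<eta>"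
    unfolding continuous_at_eps_delta using \<eta>(1) by blast
  have "dist (x t) p < e" if x: "ode_solution f x J" "dist (x 0) p < d" "t \<in> J" for x J t
  proof -
    have "V (x t) \<le> V (x 0)"
      by (rule lyapunov_antimono[OF x(1)]) (use x in \<open>auto simp: ode_solution_def\<close>)
    also have "\<dots> < V p + \<eta>" using d(2)[OF x(2)] by (simp add: dist_real_def)
    finally show ?thesis by (rule \<eta>(2))
  qed
  with d(1) show "\<exists>d>0. \<forall>x J. ode_solution f x J \<and> dist (x 0) p < d \<longrightarrow> (\<forall>t\<in>J. dist (x t) p < e)"
    by blast
qed

text \<open>As V never increases, one time with small V suffices. Without it the solution would stay
  in a compact set avoiding \<open>p\<close>, where the decay rate is bounded away from 0, and V
  would fall below its minimum.\<close>

lemma lyapunov_function_attractive: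
  assumes x: "ode_solution f x {0..}"
  shows "(x \<longlongrightarrow> p) at_top"
proof (rule tendstoI)
  fix e :: real assume "0 < e"
  obtain \<eta> where \<eta>: "0 < \<eta>" "\<And>u. V u < V p + \<eta> \<Longrightarrow> dist u p < e"
    using sublevel_subset_ball[OF \<open>0 < e\<close>] by blast
  have "\<exists>t\<ge>0. V (x t) < V p + \<eta>"
  proof (rule ccontr)
    assume "\<not> ?thesis"
    then have ge: "V p + \<eta> \<le> V (x t)" if "0 \<le> t" for t using that by (auto simp: not_less)
    define K where "K = {u. V u \<le> V (x 0)} \<inter> {u. V p + \<eta> \<le> V u}"
    have "closed {u. V p + \<eta> \<le> V u}"
      by (intro closed_Collect_le continuous_on_lyapunov continuous_on_const)
    then have K: "compact K" unfolding K_def by (intro compact_Int_closed compact_sublevel)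
    have xK: "x t \<in> K" if "0 \<le> t" for t
      using lyapunov_antimono[OF x, of 0 t] ge that by (simp add: K_def)
    then have "K \<noteq> {}" by blast
    then obtain k where k: "k \<in> K" "\<And>u. u \<in> K \<Longrightarrow> f u \<bullet> g u \<le> f k \<bullet> g k"
      using continuous_attains_sup[OF K _ continuous_on_subset[OF dV]] by auto
    have "k \<noteq> p" using k(1) \<eta>(1) by (auto simp: K_def)
    from decr[OF this] have neg: "f k \<bullet> g k < 0" .
    have le: "V (x t) - V (x 0) \<le> (f k \<bullet> g k) * t" if "0 \<le> t" for t
    proof -
      have t: "0 \<in> {0::real..}" "t \<in> {0..}" using that by auto
      obtain \<tau> where \<tau>: "0 \<le> \<tau>" "V (x t) - V (x 0) = (f (x \<tau>) \<bullet> g (x \<tau>)) * (t - 0)"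
        by (rule lyapunov_mvt[OF x t \<open>0 \<le> t\<close>]) simp
      have "(f (x \<tau>) \<bullet> g (x \<tau>)) * t \<le> (f k \<bullet> g k) * t"
        by (intro mult_right_mono k(2) xK \<tau>(1) that)
      with \<tau>(2) show ?thesis by simp
    qed
    \<comment> \<open>The time by which decay at rate \<open>f k \<bullet> g k\<close> has used up
      all of \<open>V (x 0) - V p\<close>.\<close>
    define t where "t = (V (x 0) - V p) / - (f k \<bullet> g k)"
    have "V p < V (x 0)" using ge[of 0] \<eta>(1) by simp
    then have "0 \<le> t" using neg by (simp add: t_def divide_nonneg_neg)
    from le[OF this] have "V (x t) - V (x 0) \<le> - (V (x 0) - V p)"
      using neg by (simp add: t_def)
    with ge[OF \<open>0 \<le> t\<close>] \<eta>(1) show False by simp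
  qed
  then obtain t0 where t0: "0 \<le> t0" "V (x t0) < V p + \<eta>" by blast
  have "dist (x t) p < e" if "t0 \<le> t" for t
    using lyapunov_antimono[OF x, of t0 t] t0 that by (intro \<eta>(2)) simp
  then show "\<forall>\<^sub>F t in at_top. dist (x t) p < e"
    unfolding eventually_at_top_linorder by blast
qed

text \<open>A solution never leaves its initial sublevel set, which is compact, so the field is
  bounded along it and a maximal solution is global.\<close>

theorem barbashin_krasovskii: "globally_asymptotically_stable f p"
  unfolding globally_asymptotically_stable_def
proof (intro conjI allI impI)
  show "equilibrium f q \<longleftrightarrow> q = p" for q
    using decr[of q] fp by (cases "q = p") (auto simp: equilibrium_def)
  show "lyapunov_stable f p" by (rule lyapunov_function_stable)
  fix x J assume max: "maximal_ode_solution f x J"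
  then have sol: "ode_solution f x J" by (simp add: maximal_ode_solution_def)
  have "bounded (f ` {u. V u \<le> V (x 0)})"
    by (intro compact_imp_bounded compact_continuous_image compact_sublevel continuous_on_subset[OF f]) auto
  then obtain B where B: "\<And>u. V u \<le> V (x 0) \<Longrightarrow> norm (f u) \<le> B"
    unfolding bounded_iff by blast
  have "norm (f (x t)) \<le> B" if "t \<in> J" for t
    by (intro B lyapunov_antimono[OF sol]) (use sol that in \<open>auto simp: ode_solution_def\<close>)
  from maximal_solution_global[OF f max this] show J: "J = {0..}" .
  show "(x \<longlongrightarrow> p) at_top"
    by (rule lyapunov_function_attractive) (use sol J in simp)
qed

end

section \<open>Gradients of convex functions\<close>

text \<open>Riesz representation in coordinates, with the uniqueness that gives the description in
  \<open>gradient\<close> its meaning.\<close>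

lemma gderiv_gradient:
  fixes f :: "'a::euclidean_space \<Rightarrow> real"
  assumes "f differentiable at x"
  shows "GDERIV f x :> gradient f x"
proof -
  obtain f' where f': "(f has_derivative f') (at x)"
    using assms by (auto simp: differentiable_def)
  define D where "D = (\<Sum>b\<in>Basis. f' b *\<^sub>R b)"
  interpret f': bounded_linear f' by (rule has_derivative_bounded_linear[OF f'])
  have "f' h = h \<bullet> D" for h
  proof -
    have "f' h = f' (\<Sum>b\<in>Basis. (h \<bullet> b) *\<^sub>R b)" by (simp add: euclidean_representation)
    also have "\<dots> = (\<Sum>b\<in>Basis. (h \<bullet> b) * f' b)" by (simp add: f'.sum f'.scaleR)
    also have "\<dots> = h \<bullet> D" by (simp add: D_def inner_sum_right mult.commute)
    finally show ?thesis .
  qed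
  then have D: "GDERIV f x :> D" using f' unfolding gderiv_def by presburger
  have "D' = D" if "GDERIV f x :> D'" for D'
  proof -
    have "(\<lambda>h. h \<bullet> D') = (\<lambda>h. h \<bullet> D)"
      using that D unfolding gderiv_def by (rule has_derivative_unique)
    then have "(D' - D) \<bullet> D' = (D' - D) \<bullet> D" by metis
    then have "(D' - D) \<bullet> (D' - D) = 0" by (simp add: inner_diff_right)
    then show ?thesis by simp
  qed
  with D show ?thesis unfolding gradient_def by (rule theI)
qed

lemma gradient_eqI:
  fixes f :: "'a::euclidean_space \<Rightarrow> real"
  assumes "GDERIV f x :> D"
  shows "gradient f x = D"
proof -
  have "f differentiable at x" using assms by (auto simp: gderiv_def differentiable_def)
  then have "GDERIV f x :> gradient f x" by (rule gderiv_gradient)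
  then have "(\<lambda>h. h \<bullet> gradient f x) = (\<lambda>h. h \<bullet> D)"
    using assms unfolding gderiv_def by (rule has_derivative_unique)
  then have "(gradient f x - D) \<bullet> gradient f x = (gradient f x - D) \<bullet> D" by metis
  then have "(gradient f x - D) \<bullet> (gradient f x - D) = 0" by (simp add: inner_diff_right)
  then show ?thesis by simp
qed

context
  fixes \<phi> :: "'a::euclidean_space \<Rightarrow> real"
  assumes diff: "\<phi> differentiable_on UNIV" and conv: "convex_on UNIV \<phi>"
begin

lemma gderiv_gradient_at: "GDERIV \<phi> y :> gradient \<phi> y"
  using diff by (intro gderiv_gradient) (simp add: differentiable_on_def)

text \<open>By convexity the difference quotients along h, for steps between 0 and 1, are at most
  \<open>\<phi> (y + h) - \<phi> y\<close>; so is their limit from the right.\<close>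

lemma gradient_inequality: "\<phi> y + h \<bullet> gradient \<phi> y \<le> \<phi> (y + h)"
proof -
  define \<psi> where "\<psi> s = \<phi> (y + s *\<^sub>R h)" for s :: real
  have "((\<lambda>s. y + s *\<^sub>R h) has_derivative (\<lambda>s. s *\<^sub>R h)) (at 0)"
    by (auto intro!: derivative_eq_intros)
  moreover have "(\<phi> has_derivative (\<lambda>h. h \<bullet> gradient \<phi> y)) (at (y + 0 *\<^sub>R h))"
    using gderiv_gradient_at[of y] by (simp add: gderiv_def)
  ultimately have "(\<psi> has_derivative (\<lambda>s. s *\<^sub>R h \<bullet> gradient \<phi> y)) (at 0)"
    unfolding \<psi>_def by (rule has_derivative_compose)
  moreover have "(\<lambda>s. s *\<^sub>R h \<bullet> gradient \<phi> y) = (*) (h \<bullet> gradient \<phi> y)"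
    by (simp add: fun_eq_iff)
  ultimately have "(\<psi> has_real_derivative h \<bullet> gradient \<phi> y) (at 0)"
    unfolding has_field_derivative_def by (simp only:)
  then have "((\<lambda>s. (\<psi> s - \<psi> 0) / (s - 0)) \<longlongrightarrow> h \<bullet> gradient \<phi> y) (at 0)"
    by (simp only: has_field_derivative_iff)
  then have "((\<lambda>s. (\<psi> s - \<psi> 0) / (s - 0)) \<longlongrightarrow> h \<bullet> gradient \<phi> y) (at_right 0)"
    by (rule filterlim_mono[OF _ order_refl at_le]) simp
  moreover have "\<forall>\<^sub>F s in at_right 0. (\<psi> s - \<psi> 0) / (s - 0) \<le> \<phi> (y + h) - \<phi> y"
  proof -
    have "\<forall>\<^sub>F s in at_right (0::real). s \<in> {0<..<1}"
      by (rule eventually_at_right_real) simp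
    then show ?thesis
    proof eventually_elim
      case (elim s)
      have "\<psi> s = \<phi> ((1 - s) *\<^sub>R y + s *\<^sub>R (y + h))"
        by (simp add: \<psi>_def algebra_simps)
      also have "\<dots> \<le> (1 - s) * \<phi> y + s * \<phi> (y + h)"
        using elim by (intro convex_onD[OF conv]) auto
      finally have "\<psi> s - \<psi> 0 \<le> s * (\<phi> (y + h) - \<phi> y)"
        by (simp add: \<psi>_def algebra_simps)
      then show ?case using elim by (simp add: pos_divide_le_eq mult.commute)
    qed
  qed
  ultimately have "h \<bullet> gradient \<phi> y \<le> \<phi> (y + h) - \<phi> y"
    by (rule tendsto_upperbound) simp
  then show ?thesis by simp
qed

text \<open>Comparing difference quotients of \<open>\<phi>\<close> at nearby points over one fixed radius \<open>r\<close> bounds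
  the gradients.\<close>

lemma continuous_on_gradient: "continuous_on UNIV (gradient \<phi>)"
  unfolding continuous_on_eq_continuous_at[OF open_UNIV]
proof
  fix y :: 'a
  have \<phi>_cont: "continuous_on S \<phi>" for S
    using differentiable_imp_continuous_on[OF diff] by (rule continuous_on_subset) simp
  show "isCont (gradient \<phi>) y"
    unfolding continuous_at_eps_delta
  proof (intro allI impI)
    fix e :: real assume "0 < e"
    have "(\<phi> has_derivative (\<lambda>h. h \<bullet> gradient \<phi> y)) (at y)"
      using gderiv_gradient_at[of y] by (simp add: gderiv_def)
    then obtain d where d: "0 < d"
      "\<And>z. norm (z - y) < d \<Longrightarrow> norm (\<phi> z - \<phi> y - (z - y) \<bullet> gradient \<phi> y) \<le> e / 4 * norm (z - y)"
      unfolding has_derivative_at_alt using \<open>0 < e\<close>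
      by (metis divide_pos_pos zero_less_numeral)
    \<comment> \<open>Half of \<open>d\<close>, as the derivative estimate needs increments of norm
      r strictly below \<open>d\<close>.\<close>
    define r where "r = d / 2"
    have r: "0 < r" "r < d" using d(1) by (auto simp: r_def)
    \<comment> \<open>Radius r + 1 leaves room for z + h with z within 1 of y. Below, two changes of
      \<open>\<phi>\<close> cost e r / 8 each and the linearisation e r / 4, together e r /
      2.\<close>
    have "uniformly_continuous_on (cball y (r + 1)) \<phi>"
      by (intro compact_uniformly_continuous \<phi>_cont) simp
    moreover have "0 < e * r / 8" using \<open>0 < e\<close> r by simp
    ultimately obtain d' where d': "0 < d'"
      "\<And>z z'. z \<in> cball y (r + 1) \<Longrightarrow> z' \<in> cball y (r + 1) \<Longrightarrow> dist z' z < d' \<Longrightarrow> dist (\<phi> z') (\<phi> z) < e * r / 8"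
      unfolding uniformly_continuous_on_def by blast
    have "dist (gradient \<phi> z) (gradient \<phi> y) < e" if z: "dist z y < min 1 d'" for z
    proof -
      define k where "k = gradient \<phi> z - gradient \<phi> y"
      show ?thesis
      proof (cases "k = 0")
        case True
        then show ?thesis using \<open>0 < e\<close> by (simp add: k_def)
      next
        case False
        \<comment> \<open>Pointing along the gradient difference makes the inner product with
          \<open>k\<close> equal to r * norm k.\<close>
        define h where "h = (r / norm k) *\<^sub>R k"
        have h: "norm h = r" using False r by (simp add: h_def)
        have "\<phi> (z + h) - \<phi> (y + h) \<le> dist (\<phi> (z + h)) (\<phi> (y + h))"
          by (simp add: dist_real_def)
        also have "\<dots> < e * r / 8"
        proof (rule d'(2))
          show "y + h \<in> cball y (r + 1)" using h by (simp add: dist_norm)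
          have "norm (y - (z + h)) \<le> norm (y - z) + norm h"
            using norm_triangle_ineq4[of "y - z" h] by (simp add: algebra_simps)
          then show "z + h \<in> cball y (r + 1)"
            using z h by (simp add: dist_norm norm_minus_commute)
          show "dist (z + h) (y + h) < d'" using z by (simp add: dist_norm)
        qed
        finally have 1: "\<phi> (z + h) - \<phi> (y + h) < e * r / 8" .
        have "\<phi> y - \<phi> z \<le> dist (\<phi> z) (\<phi> y)" by (simp add: dist_real_def)
        also have "\<dots> < e * r / 8"
          by (rule d'(2)) (use z r in \<open>auto simp: dist_commute\<close>)
        finally have 2: "\<phi> y - \<phi> z < e * r / 8" .
        have "norm (\<phi> (y + h) - \<phi> y - (y + h - y) \<bullet> gradient \<phi> y) \<le> e / 4 * norm (y + h - y)"
          by (rule d(2)) (use h r in simp)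
        then have "\<bar>\<phi> (y + h) - \<phi> y - h \<bullet> gradient \<phi> y\<bar> \<le> e / 4 * r"
          using h by simp
        then have 3: "\<phi> (y + h) - \<phi> y - h \<bullet> gradient \<phi> y \<le> e / 4 * r"
          by (rule abs_le_D1)
        have "h \<bullet> k = h \<bullet> gradient \<phi> z - h \<bullet> gradient \<phi> y"
          by (simp add: k_def inner_diff_right)
        also have "\<dots> < e / 2 * r"
          using gradient_inequality[of z h] 1 2 3 by simp
        also have "h \<bullet> k = r * norm k"
          using False by (simp add: h_def dot_square_norm power2_eq_square)
        finally have "norm k < e / 2" using r by (simp add: mult.commute)
        then show ?thesis using \<open>0 < e\<close> by (simp add: k_def dist_norm)
      qed
    qed
    then show "\<exists>d>0. \<forall>z. dist z y < d \<longrightarrow> dist (gradient \<phi> z) (gradient \<phi> y) < e"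
      using d'(1) by (intro exI[of _ "min 1 d'"]) auto
  qed
qed

end

section \<open>Minimisers of strictly convex functions\<close>

lemma strictly_convex_imp_convex_on:
  assumes "strictly_convex \<phi>"
  shows "convex_on UNIV \<phi>"
proof (rule convex_onI)
  fix t x y assume "0 < t" "t < (1::real)"
  then show "\<phi> ((1 - t) *\<^sub>R x + t *\<^sub>R y) \<le> (1 - t) * \<phi> x + t * \<phi> y"
    using assms unfolding strictly_convex_def
    by (cases "x = y") (auto simp: less_imp_le algebra_simps)
qed simp

lemma radially_unbounded_attains_inf:
  fixes \<phi> :: "'a::euclidean_space \<Rightarrow> real"
  assumes cont: "continuous_on UNIV \<phi>" and unbdd: "radially_unbounded \<phi>"
  obtains z where "\<And>y. \<phi> z \<le> \<phi> y"
proof -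
  have "\<forall>\<^sub>F y in at_infinity. \<phi> 0 < \<phi> y"
    using unbdd unfolding radially_unbounded_def filterlim_at_top_dense by blast
  then obtain b where b: "\<And>y. b \<le> norm y \<Longrightarrow> \<phi> 0 < \<phi> y"
    unfolding eventually_at_infinity by blast
  have "cball (0::'a) \<bar>b\<bar> \<noteq> {}" by simp
  then obtain z where z: "\<And>y. y \<in> cball 0 \<bar>b\<bar> \<Longrightarrow> \<phi> z \<le> \<phi> y"
    using continuous_attains_inf[OF compact_cball _ continuous_on_subset[OF cont]] by (metis subset_UNIV)
  show ?thesis
  proof (rule that[of z])
    fix y
    show "\<phi> z \<le> \<phi> y"
    proof (cases "y \<in> cball 0 \<bar>b\<bar>")
      case False
      then have "\<phi> 0 < \<phi> y" by (intro b) (simp add: abs_if split: if_splits)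
      moreover have "\<phi> z \<le> \<phi> 0" by (rule z) simp
      ultimately show ?thesis by simp
    qed (rule z)
  qed
qed

lemma strictly_convex_minimizer_unique:
  assumes conv: "strictly_convex \<phi>" and min: "\<And>y. \<phi> z \<le> \<phi> y" and "y \<noteq> z"
  shows "\<phi> z < \<phi> y"
proof (rule ccontr)
  assume "\<not> \<phi> z < \<phi> y"
  with min[of y] have eq: "\<phi> y = \<phi> z" by simp
  have "\<phi> ((1 - 1 / 2) *\<^sub>R y + (1 / 2) *\<^sub>R z) < (1 - 1 / 2) * \<phi> y + (1 / 2) * \<phi> z"
    using conv[unfolded strictly_convex_def, rule_format, of y z "1 / 2"] \<open>y \<noteq> z\<close> by simp
  with eq min[of "(1 - 1 / 2) *\<^sub>R y + (1 / 2) *\<^sub>R z"] show False by simp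
qed

section \<open>Stability of the gradient flow\<close>

lemma invertible_cancel_right:
  fixes A B D :: "real^'n^'n"
  assumes D: "invertible D" and eq: "A ** D = B ** D"
  shows "A = B"
proof -
  have "A ** (D ** matrix_inv D) = B ** (D ** matrix_inv D)"
    using eq by (simp only: matrix_mul_assoc)
  then show ?thesis by (simp only: matrix_inv_inverse(1)[OF D] matrix_mul_rid)
qed

lemma matrix_diff_rdistrib:
  fixes A B C :: "real^'n^'n"
  shows "(A - B) ** C = A ** C - B ** C"
  by (simp add: matrix_matrix_mult_def vec_eq_iff left_diff_distrib sum_subtractf)

lemma positive_definite_add:
  assumes "positive_definite A" "positive_definite B"
  shows "positive_definite (A + B)"
proof -
  have "transpose (A + B) = transpose A + transpose B"
    by (simp add: transpose_def vec_eq_iff)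
  moreover have "0 < x \<bullet> ((A + B) *v x)" if "x \<noteq> 0" for x
    unfolding matrix_vector_mult_add_rdistrib inner_add_right
    by (rule add_pos_pos) (use assms that in \<open>auto simp: positive_definite_def\<close>)
  ultimately show ?thesis using assms by (simp add: positive_definite_def)
qed

text \<open>The quadratic form of \<Pi>hat G^T is written as an inner product because, for x a
  gradient of \<phi>, its factors are the vector field up to -\<epsilon> and the gradient of the
  Lyapunov function.\<close>

lemma estimate_positive:
  fixes G L \<Sigma>r \<Sigma>w \<Lambda> \<Pi>hat :: "real^'n^'n"
  assumes L: "invertible L" and r: "positive_definite \<Sigma>r" and w: "positive_definite \<Sigma>w"
    and \<Lambda>: "\<Lambda> = \<Sigma>r ** matrix_inv (\<Sigma>r + \<Sigma>w)"
    and est: "(\<Pi>hat - G) ** L ** (\<Sigma>r + \<Sigma>w) = - \<Sigma>w"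
    and lmi: "(1/2) *\<^sub>R ((mat 1 - \<Lambda>) ** matrix_inv L ** transpose G)
         + (1/2) *\<^sub>R (G ** transpose (matrix_inv L) ** transpose (mat 1 - \<Lambda>))
         \<prec>\<^sub>L G ** transpose G"
    and "x \<noteq> 0"
  shows "0 < (transpose \<Pi>hat *v x) \<bullet> (transpose G *v x)"
proof -
  have D: "invertible (\<Sigma>r + \<Sigma>w)"
    by (rule positive_definite_invertible[OF positive_definite_add[OF r w]])
  have "\<Lambda> ** (\<Sigma>r + \<Sigma>w) = \<Sigma>r"
    by (simp add: \<Lambda> matrix_mul_assoc[symmetric] matrix_inv_inverse(2)[OF D])
  \<comment> \<open>Gives \<open>- \<Sigma>w\<close> the same right factor as in the estimate, so
    that \<open>\<Sigma>r + \<Sigma>w\<close> can be cancelled.\<close>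
  then have "(\<Lambda> - mat 1) ** (\<Sigma>r + \<Sigma>w) = - \<Sigma>w"
    by (simp add: matrix_diff_rdistrib)
  then have "(\<Pi>hat - G) ** L ** (\<Sigma>r + \<Sigma>w) = (\<Lambda> - mat 1) ** (\<Sigma>r + \<Sigma>w)"
    by (simp only: est)
  then have "(\<Pi>hat - G) ** L = \<Lambda> - mat 1"
    by (rule invertible_cancel_right[OF D])
  then have "(\<Pi>hat - G) ** L = (\<Lambda> - mat 1) ** matrix_inv L ** L"
    by (simp only: matrix_mul_assoc[symmetric] matrix_inv_inverse(2)[OF L] matrix_mul_rid)
  then have \<Pi>: "\<Pi>hat - G = (\<Lambda> - mat 1) ** matrix_inv L"
    by (rule invertible_cancel_right[OF L])
  define N where "N = (mat 1 - \<Lambda>) ** matrix_inv L ** transpose G"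
  have NT: "G ** transpose (matrix_inv L) ** transpose (mat 1 - \<Lambda>) = transpose N"
    by (simp add: N_def matrix_transpose_mul matrix_mul_assoc)
  have "\<Pi>hat ** transpose G = G ** transpose G + (\<Pi>hat - G) ** transpose G"
    by (simp add: matrix_diff_rdistrib)
  also have "(\<Pi>hat - G) ** transpose G = - N"
    unfolding \<Pi> N_def by (simp only: matrix_diff_rdistrib minus_diff_eq)
  finally have \<Pi>G: "\<Pi>hat ** transpose G = G ** transpose G - N" by simp
  have "x \<bullet> (transpose N *v x) = x \<bullet> (N *v x)"
    using inner_transpose_matrix_vector[of N x x] by (simp only: inner_commute)
  then have half: "x \<bullet> (((1/2) *\<^sub>R N + (1/2) *\<^sub>R transpose N) *v x) = x \<bullet> (N *v x)"
    by (simp only: matrix_vector_mult_add_rdistrib scaleR_matrix_vector_assoc[symmetric]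
        inner_add_right inner_scaleR_right)
  have "0 < x \<bullet> ((G ** transpose G - ((1/2) *\<^sub>R N + (1/2) *\<^sub>R transpose N)) *v x)"
    using lmi \<open>x \<noteq> 0\<close> unfolding N_def[symmetric] NT loewner_less_def positive_definite_def by blast
  also have "\<dots> = x \<bullet> ((\<Pi>hat ** transpose G) *v x)"
    unfolding \<Pi>G by (simp only: matrix_vector_mult_diff_rdistrib inner_diff_right half)
  also have "\<dots> = (transpose \<Pi>hat *v x) \<bullet> (transpose G *v x)"
    unfolding inner_transpose_matrix_vector by (simp only: matrix_vector_mul_assoc)
  finally show ?thesis .
qed

text \<open>Invertibility bounds norm v by a multiple of norm (G v), so large states have large
  outputs; the offset only shifts the threshold.\<close>

lemma radially_unbounded_affine:
  fixes \<phi> :: "real^'n \<Rightarrow> real" and G :: "real^'n^'n"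
  assumes \<phi>: "radially_unbounded \<phi>" and G: "invertible G"
  shows "radially_unbounded (\<lambda>v. \<phi> (G *v v + c))"
proof -
  obtain B where B: "0 < B" "\<And>x. norm (matrix_inv G *v x) \<le> norm x * B"
    using bounded_linear.pos_bounded[OF matrix_vector_mul_bounded_linear[of "matrix_inv G"]] by blast
  have "filterlim (\<lambda>v. G *v v + c) at_infinity at_infinity"
    unfolding filterlim_at_infinity[OF order_refl]
  proof (intro allI impI)
    fix \<rho> :: real assume "0 < \<rho>"
    have "\<rho> \<le> norm (G *v v + c)" if "(\<rho> + norm c) * B \<le> norm v" for v
    proof -
      have "norm v = norm (matrix_inv G *v (G *v v))"
        by (simp only: matrix_inv_mult_vector(1)[OF G])
      also have "\<dots> \<le> norm (G *v v) * B" by (rule B(2))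
      finally have "\<rho> + norm c \<le> norm (G *v v)"
        using that mult_le_cancel_right_pos[OF B(1), of "\<rho> + norm c" "norm (G *v v)"] by linarith
      moreover have "norm (G *v v) \<le> norm (G *v v + c) + norm c"
        using norm_triangle_ineq4[of "G *v v + c" c] by simp
      ultimately show ?thesis by linarith
    qed
    then show "\<forall>\<^sub>F v in at_infinity. \<rho> \<le> norm (G *v v + c)"
      unfolding eventually_at_infinity by blast
  qed
  with \<phi> show ?thesis
    unfolding radially_unbounded_def by (rule filterlim_compose)
qed

text \<open>The Lyapunov function is \<open>\<phi>\<close> itself, as a function of the state \<open>u\<close>.\<close>

lemma gradient_flow_globally_asymptotically_stable:
  fixes G A :: "real^'n^'n" and \<phi> :: "real^'n \<Rightarrow> real"
  assumes G: "invertible G"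
    and pos: "\<And>x. x \<noteq> 0 \<Longrightarrow> 0 < (transpose A *v x) \<bullet> (transpose G *v x)"
    and diff: "\<phi> differentiable_on UNIV" and conv: "strictly_convex \<phi>" and unbdd: "radially_unbounded \<phi>"
    and "\<epsilon> > 0"
  shows "\<exists>ustar. globally_asymptotically_stable
             (\<lambda>v. - \<epsilon> *\<^sub>R (transpose A *v gradient \<phi> (G *v v + c))) ustar
         \<and> {z. is_arg_min \<phi> (\<lambda>_. True) z} = {G *v ustar + c}"
proof -
  note convex = strictly_convex_imp_convex_on[OF conv]
  obtain z where z: "\<And>y. \<phi> z \<le> \<phi> y"
    using radially_unbounded_attains_inf[OF differentiable_imp_continuous_on[OF diff] unbdd] by blast
  note z_strict = strictly_convex_minimizer_unique[OF conv z]
  define p where "p = matrix_inv G *v (z - c)"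
  have Gp: "G *v p + c = z" by (simp add: p_def matrix_inv_mult_vector(2)[OF G])
  have Gv: "G *v v + c \<noteq> z" if "v \<noteq> p" for v
  proof
    assume "G *v v + c = z"
    then have "G *v v = z - c" by (simp only: eq_diff_eq)
    then have "matrix_inv G *v (G *v v) = p" by (simp only: p_def)
    then show False using that by (simp add: matrix_inv_mult_vector(1)[OF G])
  qed
  have grad_z: "gradient \<phi> z = 0"
  proof (rule gradient_eqI)
    have d: "(\<phi> has_derivative (\<lambda>h. h \<bullet> gradient \<phi> z)) (at z)"
      using gderiv_gradient_at[OF diff convex, of z] by (simp add: gderiv_def)
    have "(\<lambda>h. h \<bullet> gradient \<phi> z) = (\<lambda>h. 0)"
      by (rule has_derivative_local_min[OF d]) (simp add: z)
    with d show "GDERIV \<phi> z :> 0" by (simp add: gderiv_def)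
  qed
  \<comment> \<open>Convexity makes every critical point a global minimiser, and strictness leaves
    only \<open>z\<close>.\<close>
  have grad_nz: "gradient \<phi> y \<noteq> 0" if "y \<noteq> z" for y
  proof
    assume "gradient \<phi> y = 0"
    then have "\<phi> y \<le> \<phi> z" using gradient_inequality[OF diff convex, of y "z - y"] by simp
    with z_strict[OF that] show False by simp
  qed
  define f where "f v = - \<epsilon> *\<^sub>R (transpose A *v gradient \<phi> (G *v v + c))" for v
  define g where "g v = transpose G *v gradient \<phi> (G *v v + c)" for v
  have affine: "continuous_on UNIV (\<lambda>v. G *v v + c)"
    by (intro continuous_on_add continuous_on_const linear_continuous_on matrix_vector_mul_bounded_linear)
  have grad_cont: "continuous_on UNIV (\<lambda>v. gradient \<phi> (G *v v + c))"
    by (rule continuous_on_compose2[OF continuous_on_gradient[OF diff convex] affine]) simp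
  have mult_cont: "continuous_on UNIV (\<lambda>v. B *v gradient \<phi> (G *v v + c))" for B :: "real^'n^'n"
    by (rule continuous_on_compose2[where t = UNIV, OF linear_continuous_on[OF matrix_vector_mul_bounded_linear] grad_cont]) simp
  have f_cont: "continuous_on UNIV f"
    unfolding f_def by (intro continuous_on_scaleR continuous_on_const mult_cont)
  have fg: "f v \<bullet> g v = - \<epsilon> * ((transpose A *v gradient \<phi> (G *v v + c)) \<bullet> (transpose G *v gradient \<phi> (G *v v + c)))" for v
    by (simp only: f_def g_def inner_scaleR_left)
  have "globally_asymptotically_stable f p"
  proof (rule barbashin_krasovskii[where V = "\<lambda>v. \<phi> (G *v v + c)" and g = g])
    show "GDERIV (\<lambda>v. \<phi> (G *v v + c)) u :> g u" for u
    proof -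
      have "((\<lambda>v. G *v v + c) has_derivative (\<lambda>h. G *v h)) (at u)"
        using has_derivative_add[OF bounded_linear_imp_has_derivative[OF matrix_vector_mul_bounded_linear[of G]] has_derivative_const]
        by simp
      moreover have "(\<phi> has_derivative (\<lambda>h. h \<bullet> gradient \<phi> (G *v u + c))) (at (G *v u + c))"
        using gderiv_gradient_at[OF diff convex] by (simp add: gderiv_def)
      ultimately have "((\<lambda>v. \<phi> (G *v v + c)) has_derivative (\<lambda>h. (G *v h) \<bullet> gradient \<phi> (G *v u + c))) (at u)"
        by (rule has_derivative_compose)
      moreover have "(G *v h) \<bullet> d = h \<bullet> (transpose G *v d)" for h d
        using inner_transpose_matrix_vector[of G d h] by (simp only: inner_commute)
      ultimately show ?thesis by (simp only: gderiv_def g_def)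
    qed
    show "continuous_on UNIV (\<lambda>u. f u \<bullet> g u)"
      unfolding f_def g_def
      by (intro continuous_on_inner continuous_on_scaleR continuous_on_const mult_cont)
    show "f p = 0" by (simp add: f_def Gp grad_z)
    show "f u \<bullet> g u < 0" if "u \<noteq> p" for u
      unfolding fg using \<open>\<epsilon> > 0\<close> pos[OF grad_nz[OF Gv[OF that]]] by (simp only: mult_minus_left neg_less_0_iff_less mult_pos_pos)
    show "\<phi> (G *v p + c) < \<phi> (G *v u + c)" if "u \<noteq> p" for u
      unfolding Gp by (rule z_strict[OF Gv[OF that]])
  qed (rule f_cont radially_unbounded_affine[OF unbdd G])+
  moreover have "{y. is_arg_min \<phi> (\<lambda>_. True) y} = {G *v p + c}"
    unfolding Gp is_arg_min_def
  proof (intro set_eqI iffI)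
    fix y assume "y \<in> {y. True \<and> \<not> (\<exists>x. True \<and> \<phi> x < \<phi> y)}"
    then show "y \<in> {z}" using z_strict[of y] by auto
  next
    fix y assume "y \<in> {z}"
    then show "y \<in> {y. True \<and> \<not> (\<exists>x. True \<and> \<phi> x < \<phi> y)}" using z by (simp add: not_less)
  qed
  ultimately show ?thesis unfolding f_def by blast
qed

theorem theorem2:
  fixes G K \<Pi>true S \<Sigma>r \<Sigma>w \<Lambda> \<Pi>hat :: "real^'n^'n"
    and M :: "'w measure"
    and r w u y :: "nat \<Rightarrow> 'w \<Rightarrow> real^'n"
    and \<Pi>est :: "nat \<Rightarrow> 'w \<Rightarrow> real^'n^'n"
    and \<sigma> \<epsilon> :: real
    and \<phi> :: "real^'n \<Rightarrow> real"
    and w0 :: "real^'n"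
  assumes "invertible G" and "invertible K" and "invertible (mat 1 + G ** K)"
    and "\<Pi>true = G"
    and "S = matrix_inv (mat 1 + G ** K)"
    and "positive_definite \<Sigma>r" and "positive_definite \<Sigma>w"
    and "\<Lambda> = \<Sigma>r ** matrix_inv (\<Sigma>r + \<Sigma>w)"
    and "prob_space M"
    and "stationary_process M (\<lambda>t \<omega>. (r t \<omega>, w t \<omega>))"
    and "ergodic_process M (\<lambda>t \<omega>. (r t \<omega>, w t \<omega>))"
    and "\<And>t. t \<ge> 1 \<Longrightarrow> jointly_gaussian M (r t) (w t)"
    and "\<And>t. t \<ge> 1 \<Longrightarrow> distributed M lborel (r t) (mvn_density 0 \<Sigma>r)"
    and "\<And>t. t \<ge> 1 \<Longrightarrow> distributed M lborel (w t) (mvn_density 0 \<Sigma>w)"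
    and "\<And>t. t \<ge> 1 \<Longrightarrow> uncorrelated M (r t) (w t)"
    and "\<And>t \<omega>. t \<ge> 1 \<Longrightarrow> \<omega> \<in> space M \<Longrightarrow> y t \<omega> = G *v u t \<omega> + w t \<omega>"
    and "\<And>t \<omega>. t \<ge> 1 \<Longrightarrow> \<omega> \<in> space M \<Longrightarrow> u t \<omega> = K *v (r t \<omega> - y t \<omega>)"
    and "\<sigma> > 0"
    and "\<And>T \<omega>. T \<ge> 1 \<Longrightarrow> \<omega> \<in> space M \<Longrightarrow>
           is_arg_max
             (\<lambda>P. 1 / real T * (\<Sum>t=1..T. ln (mvn_density (P *v u t \<omega>) (\<sigma>\<^sup>2 *\<^sub>R mat 1) (y t \<omega>))))
             (\<lambda>_. True) (\<Pi>est T \<omega>)"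
    and "AE \<omega> in M. (\<lambda>T. \<Pi>est T \<omega>) \<longlonglongrightarrow> \<Pi>hat"
    and "(1/2) *\<^sub>R ((mat 1 - \<Lambda>) ** matrix_inv (K ** S) ** transpose G)
         + (1/2) *\<^sub>R (G ** transpose (matrix_inv (K ** S)) ** transpose (mat 1 - \<Lambda>))
         \<prec>\<^sub>L G ** transpose G"
    and "\<phi> differentiable_on UNIV" and "strictly_convex \<phi>" and "radially_unbounded \<phi>"
    and "\<epsilon> > 0"
  shows "\<exists>ustar.
           globally_asymptotically_stable
             (\<lambda>v. - \<epsilon> *\<^sub>R (transpose \<Pi>hat *v gradient \<phi> (\<Pi>true *v v + w0))) ustar
         \<and> {z. is_arg_min \<phi> (\<lambda>_. True) z} = {\<Pi>true *v ustar + w0}"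
proof -
  interpret prob_space M by (rule assms(9))
  \<comment> \<open>\<open>order_refl\<close> specialises the distributional assumptions to t = 1;
    stationarity makes that single time represent all others in the averages.\<close>
  have est: "(\<Pi>hat - G) ** (K ** S) ** (\<Sigma>r + \<Sigma>w) = - \<Sigma>w"
    unfolding \<open>S = matrix_inv (mat 1 + G ** K)\<close>
    by (rule closed_loop_estimate[where r = r and w = w and u = u and y = y and \<Pi>est = \<Pi>est and \<sigma> = \<sigma>])
       (use assms in \<open>blast intro: order_refl\<close>)+
  have "invertible (K ** S)"
    unfolding \<open>S = matrix_inv (mat 1 + G ** K)\<close>
    by (rule invertible_mult[OF assms(2) invertible_matrix_inv[OF assms(3)]])
  note pos = estimate_positive[OF this assms(6,7,8) est assms(21)]
  show ?thesis
    unfolding \<open>\<Pi>true = G\<close>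
    by (rule gradient_flow_globally_asymptotically_stable[OF assms(1) pos assms(22-25)])
qed

end
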